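(* Let $n\ge 2$ be even. A configuration $(\sigma,\tau_{c_i},\rho_{c_i},\rho_{e_{i,j}},x,y_i)\in\mathcal{S}_{\text{conf}}$ of the $n\times n\times n$ Rubik's Cube is valid if it satisfies: (1) $\operatorname{sgn}(\sigma)=\operatorname{sgn}(\rho_{c_i})$ for every center corner orbit $i$; (2) $\operatorname{sgn}(\rho_{e_{i,j}})=\operatorname{sgn}(\sigma)\operatorname{sgn}(\tau_i)\operatorname{sgn}(\tau_j)$ for every center edge orbit $(i,j)$, where $\tau_k$ denotes $\tau_{c_k}$; (3) $\sum_{k=1}^8 x_k=0$ in $\mathbb{Z}_3$; (4) $y_i=0$ for every coupled edge orbit $i$.
   Context: Cube and moves: the $n\times n\times n$ Rubik's Cube has faces U, D, F, B, R, L, each an $n\times n$ grid of facelets carrying stickers; in the solved state each face is monochromatic with six distinct colors. For $1\le k\le n/2$, $F_k,B_k,R_k,L_k,U_k,D_k$ denote clockwise (seen from the named face) $90^\circ$ rotations of the $k$-th slice counted from the named face. A configuration is valid if it is obtained from the solved state by a sequence of these moves. Cubie types ($n$ even): 8 corners (3 stickers); along each of the 12 edges lie edge cubies at positions $2,\dots,n-1$; for $2\le i\le n/2$ the 24 edge cubies at positions $i$ and $n+1-i$ form coupled edge orbit $i$. On each face index facelets $(r,c)$, $1\le r,c\le n$; for $2\le i\le n/2$ the center corner orbit $i$ is the 24 facelets with $r,c\in\{i,n+1-i\}$; for $2\le i,j\le n/2$, $j\ne i$, the center edge orbit $(i,j)$ is the 24 facelets occupying on each face the positions $(i,j),(j,n+1-i),(n+1-i,n+1-j),(n+1-j,i)$.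 $\mathcal{S}_{\text{conf}}$ is the set of arrangements obtained from the solved cube by disassembling and reassembling cubies, each cubie placed in a position of its own orbit (corners among corner positions, coupled edges of orbit $i$ within orbit $i$, centers of an orbit within that orbit), corners in any of 3 rotations and edges in either of 2 orientations. Such an arrangement is the tuple: $\sigma\in S_8$ (corner permutation), $\tau_{c_i}\in S_{24}$ (coupled edges of orbit $i$), $\rho_{c_i}\in S_{24}$ (center corners of orbit $i$), $\rho_{e_{i,j}}\in S_{24}$ (center edges of orbit $(i,j)$), $x\in\mathbb{Z}_3^8$ (corner orientations), $y_i\in\mathbb{Z}_2^{24}$ (coupled edge orientations of orbit $i$); the solved state has identity permutations and zero orientations. Orientations: a corner has exactly one sticker of the color of the (solved) white or yellow face, a designated pair of opposite faces; its orientation is $0$ if that sticker lies on the white or yellow face, $1$/$2$ if rotated one/two steps clockwise from that. For coupled edges, a coupled-edge facelet on face $X$ along the edge shared with face $Y$ is left-handed if, viewing $X$ from outside with that edge at the top, it lies left of the edge's midpoint; $y_{i,k}=0$ iff the sticker of the cubie at position $k$ of orbit $i$ that lay on a left-handed facelet in the solved state lies on a left-handed facelet. *)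

theory Defs
  imports
    Complex_Main
    "HOL-Library.Numeral_Type"
    "HOL-Library.Product_Plus"
    "HOL-Combinatorics.Permutations"
begin

section \<open>Geometry\<close>

text \<open>
  The cube of order \<open>n\<close> is the solid \<open>[-n, n]\<^sup>3\<close>, so a cubie has side 2. The x, y, z axes point
  to the faces R, U, F respectively (a right-handed frame). Cubies and facelets are both represented
  by their centres: a cubie has odd coordinates of absolute value at most \<open>n - 1\<close> (for even \<open>n\<close>),
  and the facelet of the cubie \<open>p\<close> on the face \<open>X\<close> is \<open>p + normal X\<close>.
\<close>

type_synonym point = "int \<times> int \<times> int"

datatype face = U | D | F | B | R | L

fun opposite :: "face \<Rightarrow> face" where
  "opposite U = D"
| "opposite D = U"
| "opposite F = B"
| "opposite B = F"
| "opposite R = L"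
| "opposite L = R"

fun normal :: "face \<Rightarrow> point" where
  "normal U = (0, 1, 0)"
| "normal D = (0, -1, 0)"
| "normal F = (0, 0, 1)"
| "normal B = (0, 0, -1)"
| "normal R = (1, 0, 0)"
| "normal L = (-1, 0, 0)"

fun dot :: "point \<Rightarrow> point \<Rightarrow> int" where
  "dot (x, y, z) (x', y', z') = x * x' + y * y' + z * z'"

text \<open>
  \<open>turn X\<close> is the rotation of space by 90 degrees about the axis of \<open>X\<close>, clockwise as seen by an
  observer looking at the face \<open>X\<close> from outside; it is \<open>p \<mapsto> (p \<bullet> d) d + p \<times> d\<close> with \<open>d = normal X\<close>.
\<close>

fun turn :: "face \<Rightarrow> point \<Rightarrow> point" where
  "turn U (x, y, z) = (-z, y, x)"
| "turn D (x, y, z) = (z, y, -x)"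
| "turn F (x, y, z) = (y, -x, z)"
| "turn B (x, y, z) = (-y, x, z)"
| "turn R (x, y, z) = (x, z, -y)"
| "turn L (x, y, z) = (x, -z, y)"

definition coord :: "nat \<Rightarrow> nat \<Rightarrow> int" where
  "coord n k = 2 * int k - int n - 1"

text \<open>
  The facelet in row \<open>r\<close> and column \<open>c\<close> of a face, rows counted downwards and columns to the right
  as seen from outside. The sides at the top are: B for U, F for D, and U for the other four faces.
\<close>

fun facelet :: "nat \<Rightarrow> face \<Rightarrow> nat \<Rightarrow> nat \<Rightarrow> point" where
  "facelet n U r c = (coord n c, int n, coord n r)"
| "facelet n D r c = (coord n c, - int n, - coord n r)"
| "facelet n F r c = (coord n c, - coord n r, int n)"
| "facelet n B r c = (- coord n c, - coord n r, - int n)"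
| "facelet n R r c = (int n, - coord n r, - coord n c)"
| "facelet n L r c = (- int n, - coord n r, coord n c)"

definition facelets :: "nat \<Rightarrow> point set" where
  "facelets n = {facelet n X r c | X r c. r \<in> {1..n} \<and> c \<in> {1..n}}"


section \<open>Moves\<close>

text \<open>
  The \<open>k\<close>-th slice counted from \<open>X\<close> is the \<open>k\<close>-th slab of thickness 2 orthogonal to \<open>normal X\<close>.
  For \<open>k = 1\<close> it contains all facelets of the face \<open>X\<close>.
\<close>

definition slice :: "nat \<Rightarrow> face \<Rightarrow> nat \<Rightarrow> point set" where
  "slice n X k = {p. int n - 2 * int k < dot p (normal X) \<and> dot p (normal X) \<le> int n - 2 * int k + 2}"

definition move :: "nat \<Rightarrow> face \<Rightarrow> nat \<Rightarrow> point \<Rightarrow> point" where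
  "move n X k f = (if f \<in> facelets n \<inter> slice n X k then turn X f else f)"

text \<open>
  A state of the cube is the map sending each facelet \<open>f\<close> to the facelet on which the sticker that was
  at \<open>f\<close> in the solved state lies now.
\<close>

inductive_set reachable :: "nat \<Rightarrow> (point \<Rightarrow> point) set" for n :: nat where
  solved: "id \<in> reachable n"
| step: "g \<in> reachable n \<Longrightarrow> 1 \<le> k \<Longrightarrow> 2 * k \<le> n \<Longrightarrow> move n X k \<circ> g \<in> reachable n"


section \<open>Orbits\<close>

definition corners :: "nat \<Rightarrow> point set" where
  "corners n = (let E = {coord n 1, coord n n} in E \<times> E \<times> E)"

definition coupled_edges :: "nat \<Rightarrow> nat \<Rightarrow> point set" where
  "coupled_edges n i =
     (let E = {coord n 1, coord n n}; M = {coord n i, coord n (n + 1 - i)}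
      in M \<times> E \<times> E \<union> E \<times> M \<times> E \<union> E \<times> E \<times> M)"

definition center_corners :: "nat \<Rightarrow> nat \<Rightarrow> point set" where
  "center_corners n i =
     {facelet n X r c | X r c. r \<in> {i, n + 1 - i} \<and> c \<in> {i, n + 1 - i}}"

definition center_edges :: "nat \<Rightarrow> nat \<Rightarrow> nat \<Rightarrow> point set" where
  "center_edges n i j =
     {facelet n X r c | X r c.
        (r, c) \<in> {(i, j), (j, n + 1 - i), (n + 1 - i, n + 1 - j), (n + 1 - j, i)}}"


section \<open>Orientations\<close>

definition on_face :: "nat \<Rightarrow> point \<Rightarrow> face \<Rightarrow> bool" where
  "on_face n p X \<longleftrightarrow> dot p (normal X) = coord n n"

text \<open>
  The three faces meeting in a corner, in clockwise order as seen from outside, are \<open>X\<close>, \<open>Y\<close>, \<open>Z\<close>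
  precisely if the clockwise turn of \<open>X\<close> carries the direction of \<open>Y\<close> to that of \<open>Z\<close>; for
  example U, R, F.
\<close>

definition clockwise_next :: "nat \<Rightarrow> point \<Rightarrow> face \<Rightarrow> face" where
  "clockwise_next n p X =
     (THE Y. Y \<noteq> X \<and> on_face n p Y \<and> (\<exists>Z. on_face n p Z \<and> turn X (normal Y) = normal Z))"

text \<open>
  The faces of the corner position \<open>p\<close>, numbered clockwise starting from the white or yellow one.
  Here \<open>w\<close> is the white face and \<open>opposite w\<close> the yellow one.
\<close>

definition corner_face :: "nat \<Rightarrow> face \<Rightarrow> point \<Rightarrow> 3 \<Rightarrow> face" where
  "corner_face n w p j =
     (let X = (THE X. X \<in> {w, opposite w} \<and> on_face n p X)
      in if j = 0 then X
         else if j = 1 then clockwise_next n p X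
         else clockwise_next n p (clockwise_next n p X))"

text \<open>
  Handedness of the facelet on \<open>X\<close> of the edge cubie position \<open>p\<close>: when \<open>X\<close> is viewed with the side
  shared with \<open>Y\<close> at the top, \<open>normal Y\<close> points up, hence \<open>turn X (normal Y)\<close> points to the right.
\<close>

definition left_handed :: "nat \<Rightarrow> point \<Rightarrow> face \<Rightarrow> bool" where
  "left_handed n p X \<longleftrightarrow> (\<exists>Y. Y \<noteq> X \<and> on_face n p Y \<and> dot p (turn X (normal Y)) < 0)"

definition edge_face :: "nat \<Rightarrow> point \<Rightarrow> 2 \<Rightarrow> face" where
  "edge_face n p j = (THE X. on_face n p X \<and> (left_handed n p X \<longleftrightarrow> j = 0))"


section \<open>Configurations\<close>

text \<open>
  The components are the corner permutation, the permutations of the coupled edge orbits, of the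
  center corner orbits and of the center edge orbits, the corner orientations and the coupled edge
  orientations. Permutations send the original position of a cubie to its present one; orientations
  are indexed by the present position. The types \<open>3\<close> and \<open>2\<close> are the rings of integers modulo 3 and 2.
\<close>

type_synonym config =
  "(point \<Rightarrow> point) \<times> (nat \<Rightarrow> point \<Rightarrow> point) \<times> (nat \<Rightarrow> point \<Rightarrow> point) \<times>
   (nat \<Rightarrow> nat \<Rightarrow> point \<Rightarrow> point) \<times> (point \<Rightarrow> 3) \<times> (nat \<Rightarrow> point \<Rightarrow> 2)"

definition orbit_indices :: "nat \<Rightarrow> nat set" where
  "orbit_indices n = {2..n div 2}"

definition S_conf :: "nat \<Rightarrow> config set" where
  "S_conf n = {(\<sigma>, \<tau>, \<rho>c, \<rho>e, x, y).
     \<sigma> permutes corners n \<and>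
     (\<forall>i\<in>orbit_indices n. \<tau> i permutes coupled_edges n i) \<and>
     (\<forall>i\<in>orbit_indices n. \<rho>c i permutes center_corners n i) \<and>
     (\<forall>i\<in>orbit_indices n. \<forall>j\<in>orbit_indices n. j \<noteq> i \<longrightarrow> \<rho>e i j permutes center_edges n i j)}"

text \<open>
  The tuple determines the place of every sticker: the sticker of a corner cubie that was on its face
  number \<open>j\<close> is now on face number \<open>j\<close> plus the orientation of the new position, and likewise for
  edge cubies, where face 0 is the one with the left-handed facelet.
\<close>

fun describes :: "nat \<Rightarrow> face \<Rightarrow> config \<Rightarrow> (point \<Rightarrow> point) \<Rightarrow> bool" where
  "describes n w (\<sigma>, \<tau>, \<rho>c, \<rho>e, x, y) g \<longleftrightarrow>
     (\<forall>p\<in>corners n. \<forall>j.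
        g (p + normal (corner_face n w p j)) =
          \<sigma> p + normal (corner_face n w (\<sigma> p) (j + x (\<sigma> p)))) \<and>
     (\<forall>i\<in>orbit_indices n. \<forall>p\<in>coupled_edges n i. \<forall>j.
        g (p + normal (edge_face n p j)) =
          \<tau> i p + normal (edge_face n (\<tau> i p) (j + y i (\<tau> i p)))) \<and>
     (\<forall>i\<in>orbit_indices n. \<forall>f\<in>center_corners n i. g f = \<rho>c i f) \<and>
     (\<forall>i\<in>orbit_indices n. \<forall>j\<in>orbit_indices n. j \<noteq> i \<longrightarrow>
        (\<forall>f\<in>center_edges n i j. g f = \<rho>e i j f))"

definition valid :: "nat \<Rightarrow> face \<Rightarrow> config \<Rightarrow> bool" where
  "valid n w C \<longleftrightarrow> (\<exists>g\<in>reachable n. describes n w C g)"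

end

theory Submission
  imports Defs
begin

text \<open>
  A single commutator does most of the work. Let \<open>r\<close> turn the layer \<open>x = a\<close>, let \<open>l\<close> turn the layer
  \<open>x = -b\<close> and let \<open>u\<close> turn the U layer (\<open>a, b > 0\<close>). The supports of \<open>r\<close> and \<open>u\<^sup>-\<^sup>1 l u\<close> meet in
  exactly one cubie, so their commutator is a 3-cycle of cubies that fixes everything else; depending
  on \<open>a\<close> and \<open>b\<close> these are centers, edges or corners. The reachable states are normalised by the
  rotations of the whole cube, and conjugating the 3-cycle by rotations connects its whole orbit. Hence
  every even permutation of an orbit is reachable without disturbing the other orbits. Turning suitable
  layers parallel to U beforehand makes all permutations even; by the hypotheses on the signs it
  suffices to do this for the corners and the edges.

  Edges cannot be flipped since the handedness of a sticker is invariant. The total corner twist is a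
  homomorphism to the integers modulo 3 that vanishes on the generators, and a product of three corner
  3-cycles twists two adjacent corners in opposite directions, so every twist of total 0 is reachable.
\<close>

section \<open>Even permutations and 3-cycles\<close>

text \<open>The commutators control where cubies go, but they also turn the corner and edge cubies
  that they move. So permutations are realised on positions alone, and orientations are settled
  afterwards: an edge has no choice once its position is known, and for the corners a last factor
  made of pure twists supplies the difference. Each correction has to fix everything outside its own
  orbit, so that the corrections of all orbits can follow one common turn of layers.

  The sign conditions are the signs of such a turn. A quarter turn of a layer parallel to U acts on
  the corners as one 4-cycle if the layer is the outer one. On edge orbit \<open>i\<close> it is one
  4-cycle in layer \<open>i\<close> and two in the outer layer. On the center orbit
  \<open>(i, j)\<close> it is one 4-cycle in each of the outer layer, layer \<open>i\<close> and
  layer \<open>j\<close>, the last two adding up to two 4-cycles in one layer when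
  \<open>i = j\<close>. Thus the parities of \<sigma> and of the \<open>\<tau> i\<close> can be
  prescribed freely, and those of the centers follow.\<close>

definition cyc3 :: "'a \<Rightarrow> 'a \<Rightarrow> 'a \<Rightarrow> 'a \<Rightarrow> 'a" where
  "cyc3 a b c = (\<lambda>x. if x = a then b else if x = b then c else if x = c then a else x)"

lemma cyc3_transpose:
  assumes "a \<noteq> b" "b \<noteq> c" "a \<noteq> c"
  shows "cyc3 a b c = transpose a b \<circ> transpose b c"
  using assms by (auto simp: cyc3_def transpose_def fun_eq_iff)

lemma cyc3_permutes:
  assumes "a \<noteq> b" "b \<noteq> c" "a \<noteq> c" "a \<in> S" "b \<in> S" "c \<in> S"
  shows "cyc3 a b c permutes S"
  using assms by (auto simp: cyc3_transpose intro!: permutes_compose permutes_swap_id)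

lemma sign_cyc3:
  assumes "a \<noteq> b" "b \<noteq> c" "a \<noteq> c"
  shows "sign (cyc3 a b c) = 1"
  using assms by (simp add: cyc3_transpose sign_compose permutation_swap_id sign_swap_id)

lemma cyc3_rotate: "a \<noteq> b \<Longrightarrow> b \<noteq> c \<Longrightarrow> a \<noteq> c \<Longrightarrow> cyc3 b c a = cyc3 a b c"
  by (auto simp: cyc3_def fun_eq_iff)

lemma inv_cyc3:
  assumes "a \<noteq> b" "b \<noteq> c" "a \<noteq> c"
  shows "inv (cyc3 a b c) = cyc3 b a c"
  by (rule inv_unique_comp) (use assms in \<open>auto simp: cyc3_def fun_eq_iff\<close>)

lemma conj_cyc3:
  assumes "bij t"
  shows "t \<circ> cyc3 a b c \<circ> inv t = cyc3 (t a) (t b) (t c)"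
proof
  fix y
  obtain x where "y = t x" using assms by (metis bij_pointE)
  then show "(t \<circ> cyc3 a b c \<circ> inv t) y = cyc3 (t a) (t b) (t c) y"
    using assms by (simp add: cyc3_def bij_is_inj inj_eq)
qed

text \<open>Induction on the number of moved points. If \<open>p\<close> sends \<open>a\<close> to
  \<open>b\<close>, then \<open>cyc3 b a c\<close> brings \<open>b\<close> back to \<open>a\<close>;
  composing with it makes \<open>a\<close> fixed and, as \<open>c\<close> is moved by
  \<open>p\<close> anyway, disturbs no point that was fixed before.\<close>

lemma even_permutation_in_cyc3_closure:
  assumes "finite S" "p permutes S" "sign p = 1"
    and one: "id \<in> T"
    and mult: "\<And>s t. s \<in> T \<Longrightarrow> t \<in> T \<Longrightarrow> s \<circ> t \<in> T"
    and cyc: "\<And>a b c. a \<in> S \<Longrightarrow> b \<in> S \<Longrightarrow> c \<in> S \<Longrightarrow> a \<noteq> b \<Longrightarrow> b \<noteq> c \<Longrightarrow> a \<noteq> c \<Longrightarrow> cyc3 a b c \<in> T"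
  shows "p \<in> T"
  using assms(2,3)
proof (induction "card {x. p x \<noteq> x}" arbitrary: p rule: less_induct)
  case less
  let ?M = "{x. p x \<noteq> x}"
  have perm: "permutation p" using less.prems(1) assms(1) by (auto simp: permutation_permutes)
  have sub: "?M \<subseteq> S" using less.prems(1) by (auto simp: permutes_def)
  then have fin: "finite ?M" using assms(1) finite_subset by blast
  have inj: "inj p" using less.prems(1) by (rule permutes_inj)
  show ?case
  proof (cases "p = id")
    case True
    then show ?thesis using one by simp
  next
    case False
    then obtain a where a: "p a \<noteq> a" by (auto simp: fun_eq_iff)
    define b where "b = p a"
    have b: "b \<noteq> a" "p b \<noteq> b" using a inj by (auto simp: b_def inj_eq)
    \<comment> \<open>Evenness enters here: a permutation that moves only \<open>a\<close> and
      \<open>b\<close> is a transposition.\<close>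
    have "\<exists>c. c \<noteq> a \<and> c \<noteq> b \<and> p c \<noteq> c"
    proof (rule ccontr)
      assume "\<nexists>c. c \<noteq> a \<and> c \<noteq> b \<and> p c \<noteq> c"
      then have fixed: "p c = c" if "c \<noteq> a" "c \<noteq> b" for c using that by blast
      have "p b = a"
      proof (rule ccontr)
        assume "p b \<noteq> a"
        then have "p (p b) = p b" using fixed b by blast
        then show False using b inj by (simp add: inj_eq)
      qed
      then have "p = transpose a b"
        using fixed by (auto simp: fun_eq_iff transpose_def b_def)
      then have "sign p = -1" using b by (simp add: sign_swap_id)
      then show False using less.prems(2) by simp
    qed
    then obtain c where c: "c \<noteq> a" "c \<noteq> b" "p c \<noteq> c" by blast
    define q where "q = cyc3 b a c \<circ> p"
    have abc: "a \<in> S" "b \<in> S" "c \<in> S" using sub a b c by auto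
    have cp: "cyc3 b a c permutes S" using abc b c by (intro cyc3_permutes) auto
    have "q permutes S" unfolding q_def using less.prems(1) cp by (rule permutes_compose)
    moreover have "sign q = 1"
      unfolding q_def using less.prems(2) perm b c cp assms(1)
      by (subst sign_compose) (auto simp: sign_cyc3 permutation_permutes)
    moreover have "{x. q x \<noteq> x} \<subset> ?M"
    proof -
      have "q a = a" by (simp add: q_def cyc3_def b_def)
      moreover have "q x = x" if "p x = x" for x
        using that a b c by (auto simp: q_def cyc3_def)
      ultimately show ?thesis using a by auto
    qed
    ultimately have "q \<in> T" using less.hyps fin by (meson psubset_card_mono)
    moreover have "cyc3 a b c \<in> T" using cyc abc b c by blast
    ultimately have "cyc3 a b c \<circ> q \<in> T" using mult by blast
    moreover have "cyc3 a b c \<circ> q = p"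
      using b c by (auto simp: q_def cyc3_def fun_eq_iff)
    ultimately show ?thesis by simp
  qed
qed

section \<open>All 3-cycles from a connected family of 3-cycles\<close>

definition linked :: "('a \<Rightarrow> 'a) set \<Rightarrow> 'a \<Rightarrow> 'a \<Rightarrow> bool" where
  "linked T p q \<longleftrightarrow> p = q \<or> (\<exists>r. r \<noteq> p \<and> r \<noteq> q \<and> p \<noteq> q \<and> cyc3 p q r \<in> T)"

locale permutation_group =
  fixes T :: "('a \<Rightarrow> 'a) set"
  assumes one_mem: "id \<in> T"
    and comp_mem: "s \<in> T \<Longrightarrow> t \<in> T \<Longrightarrow> s \<circ> t \<in> T"
    and inv_mem: "s \<in> T \<Longrightarrow> inv s \<in> T"
    and bij_mem: "s \<in> T \<Longrightarrow> bij s"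
begin

lemma conj_cyc3_mem: "t \<in> T \<Longrightarrow> cyc3 a b c \<in> T \<Longrightarrow> cyc3 (t a) (t b) (t c) \<in> T"
  using conj_cyc3 comp_mem inv_mem bij_mem by metis

lemma cyc3_inverse_mem:
  "cyc3 a b c \<in> T \<Longrightarrow> a \<noteq> b \<Longrightarrow> b \<noteq> c \<Longrightarrow> a \<noteq> c \<Longrightarrow> cyc3 b a c \<in> T"
  using inv_mem inv_cyc3 by metis

lemma linked_refl: "linked T p p"
  by (simp add: linked_def)

lemma linked_sym: "linked T p q \<Longrightarrow> linked T q p"
  using cyc3_inverse_mem unfolding linked_def by metis

text \<open>In the generic case, conjugating \<open>cyc3 q s t\<close> by \<open>cyc3 q p r\<close>
  replaces \<open>q\<close> by \<open>p\<close> and keeps \<open>s\<close>. The two exceptions are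
  those where one of the given cycles already consists of \<open>p\<close>, \<open>q\<close> and
  \<open>s\<close>.\<close>

lemma linked_trans:
  assumes "linked T p q" "linked T q s"
  shows "linked T p s"
proof (cases "p = q \<or> q = s \<or> p = s")
  case True
  then show ?thesis using assms by (auto simp: linked_refl)
next
  case False
  then obtain r t where r: "cyc3 p q r \<in> T" "r \<noteq> p" "r \<noteq> q" and t: "cyc3 q s t \<in> T" "t \<noteq> q" "t \<noteq> s"
    using assms unfolding linked_def by metis
  consider "s = r" | "t = p" | "s \<noteq> r" "t \<noteq> p" by blast
  then show ?thesis
  proof cases
    case 1
    then have "cyc3 s p q \<in> T" using r False cyc3_rotate by metis
    then have "linked T s p" unfolding linked_def using False by metis
    then show ?thesis by (rule linked_sym)
  next
    case 2
    then have "cyc3 s p q \<in> T" using t False cyc3_rotate by metis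
    then have "linked T s p" unfolding linked_def using False by metis
    then show ?thesis by (rule linked_sym)
  next
    case 3
    have "cyc3 q p r \<in> T" using r False cyc3_inverse_mem by metis
    from conj_cyc3_mem[OF this t(1)]
    have "cyc3 p s (if t = r then q else t) \<in> T"
      using r t False 3 by (auto simp: cyc3_def split: if_splits)
    then show ?thesis unfolding linked_def using False r t 3 by metis
  qed
qed

text \<open>The third point of a cycle can be exchanged at will: conjugating
  \<open>cyc3 p q r\<close> by a cycle that sends \<open>r\<close> to \<open>s\<close> gives
  \<open>cyc3 p q s\<close>. If that cycle also moves \<open>p\<close> or \<open>q\<close>, the
  roles of the two cycles are swapped and the result is inverted or rotated.\<close>

lemma cyc3_mem_if_linked:
  assumes "\<And>p q. p \<in> S \<Longrightarrow> q \<in> S \<Longrightarrow> linked T p q"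
    and "p \<in> S" "q \<in> S" "s \<in> S" "p \<noteq> q" "q \<noteq> s" "p \<noteq> s"
    and "\<And>t. t \<in> T \<Longrightarrow> t permutes S"
  shows "cyc3 p q s \<in> T"
proof -
  obtain r where r: "cyc3 p q r \<in> T" "r \<noteq> p" "r \<noteq> q"
    using assms(1)[OF assms(2,3)] assms(5) unfolding linked_def by metis
  have "r \<in> S"
  proof (rule ccontr)
    assume "r \<notin> S"
    then have "cyc3 p q r r = r" using assms(8)[OF r(1)] by (auto simp: permutes_def)
    then show False using r by (auto simp: cyc3_def split: if_splits)
  qed
  show ?thesis
  proof (cases "r = s")
    case True
    then show ?thesis using r by simp
  next
    case False
    then obtain t where t: "cyc3 r s t \<in> T" "t \<noteq> r" "t \<noteq> s"
      using assms(1)[OF \<open>r \<in> S\<close> assms(4)] unfolding linked_def by metis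
    consider "t = p" | "t = q" | "t \<noteq> p" "t \<noteq> q" by blast
    then show ?thesis
    proof cases
      case 1
      have "cyc3 q p s \<in> T"
        using conj_cyc3_mem[OF r(1) t(1)] 1 r t False assms(5-7)
        by (metis (no_types, lifting) cyc3_def cyc3_rotate)
      then show ?thesis using assms(5-7) cyc3_inverse_mem by metis
    next
      case 2
      have "cyc3 q p r \<in> T" using r assms(5-7) cyc3_inverse_mem by metis
      from conj_cyc3_mem[OF this t(1)] have "cyc3 q s p \<in> T"
        using 2 r t False assms(5-7) by (simp add: cyc3_def)
      then show ?thesis using assms(5-7) by (metis cyc3_rotate)
    next
      case 3
      from conj_cyc3_mem[OF t(1) r(1)] show ?thesis
        using 3 r t False assms(5-7) by (simp add: cyc3_def)
    qed
  qed
qed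

end

text \<open>Permutations whose supports share a single point have a 3-cycle as commutator. Here the
  common support is a set \<open>P\<close>, because a corner or edge cubie carries several facelets.
  Since neither map sends a point of \<open>P\<close> into \<open>P\<close>, these points do not
  interfere, and a 3-cycle runs through each of them.\<close>

lemma commutator_small_overlap:
  assumes "bij g" "bij h"
    and P: "\<And>x. x \<in> P \<longleftrightarrow> g x \<noteq> x \<and> h x \<noteq> x"
    and gP: "\<And>x. x \<in> P \<Longrightarrow> g x \<notin> P" and hP: "\<And>x. x \<in> P \<Longrightarrow> h x \<notin> P"
  defines "c \<equiv> g \<circ> h \<circ> inv g \<circ> inv h"
  shows "x \<in> P \<Longrightarrow> c x = g x" "x \<in> P \<Longrightarrow> c (g x) = h x" "x \<in> P \<Longrightarrow> c (h x) = x"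
    and "x \<notin> P \<Longrightarrow> x \<notin> g ` P \<Longrightarrow> x \<notin> h ` P \<Longrightarrow> c x = x"
proof -
  have inj: "inj g" "inj h" using assms(1,2) by (auto simp: bij_is_inj)
  have ig: "inv g (g y) = y" "g (inv g y) = y" and ih: "inv h (h y) = y" "h (inv h y) = y" for y
    using assms(1,2) by (auto simp: bij_is_surj surj_f_inv_f bij_is_inj)
  have g_fix: "inv g y = y \<longleftrightarrow> g y = y" for y using ig by metis
  have h_fix: "inv h y = y \<longleftrightarrow> h y = y" for y using ih by metis
  have g_move: "g (g y) = g y \<longleftrightarrow> g y = y" and h_move: "h (h y) = h y \<longleftrightarrow> h y = y" for y
    using inj by (auto simp: inj_eq)
  show "c x = g x" if "x \<in> P"
  proof -
    have "inv h x \<notin> P" using hP[of "inv h x"] ih that by auto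
    then have "g (inv h x) = inv h x" using P that h_fix ih by metis
    then have "inv g (inv h x) = inv h x" using g_fix by blast
    then show ?thesis using ih by (simp add: c_def)
  qed
  show "c (g x) = h x" if "x \<in> P"
  proof -
    have "h (g x) = g x" using P gP g_move that by metis
    moreover have "g (h x) = h x" using P hP h_move that by metis
    moreover from calculation have "inv h (g x) = g x" using h_fix by blast
    ultimately show ?thesis using ig by (simp add: c_def)
  qed
  show "c (h x) = x" if "x \<in> P"
  proof -
    have "inv g x \<notin> P" using gP[of "inv g x"] ig that by auto
    then have "h (inv g x) = inv g x" using P that g_fix ig by metis
    then show ?thesis using ig ih by (simp add: c_def)
  qed
  show "c x = x" if "x \<notin> P" "x \<notin> g ` P" "x \<notin> h ` P"
  proof (cases "h x = x")
    case True
    have "inv g x \<notin> P" using that(2) ig by (metis imageI)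
    then have "h (inv g x) = inv g x" using True P ig by metis
    moreover have "inv h x = x" using True h_fix by blast
    ultimately show ?thesis using ig by (simp add: c_def)
  next
    case False
    then have "g x = x" using P that by blast
    have "inv h x \<notin> P" using that(3) ih by (metis imageI)
    then have "g (inv h x) = inv h x" using False P ih by metis
    moreover from calculation have "inv g (inv h x) = inv h x" using g_fix by blast
    ultimately show ?thesis using \<open>g x = x\<close> ih by (simp add: c_def)
  qed
qed

section \<open>Rotations, cubies and layer turns\<close>

declare split_paired_All [simp del] split_paired_Ex [simp del]

text \<open>The orbit under the 24 rotations of the cube, that is, under the signed coordinate
  permutations of determinant 1: cyclic ones with an even number of minus signs, transpositions with
  an odd number. The explicit list makes membership decidable by simplification.\<close>

fun rots :: "point \<Rightarrow> point set" where
  "rots (x, y, z) =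
    {(x, y, z), (x, -y, -z), (-x, y, -z), (-x, -y, z),
     (y, z, x), (y, -z, -x), (-y, z, -x), (-y, -z, x),
     (z, x, y), (z, -x, -y), (-z, x, -y), (-z, -x, y),
     (-y, -x, -z), (-y, x, z), (y, -x, z), (y, x, -z),
     (-x, -z, -y), (-x, z, y), (x, -z, y), (x, z, -y),
     (-z, -y, -x), (-z, y, x), (z, -y, x), (z, y, -x)}"

lemma finite_rots: "finite (rots p)"
  by (cases p) simp

lemma self_mem_rots: "p \<in> rots p"
  by (cases p) simp

lemma turn_mem_rots: "q \<in> rots p \<Longrightarrow> turn X q \<in> rots p"
  by (cases p; cases X) (simp, elim disjE; simp)+

text \<open>The turns of U and R generate the rotation group: their squares give the half turns, and
  R followed by U is the cyclic shift of the coordinates. This serves as an induction principle over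
  the rotations.\<close>

lemma rots_subset:
  assumes "p \<in> S" and U: "\<And>q. q \<in> S \<Longrightarrow> turn U q \<in> S" and R: "\<And>q. q \<in> S \<Longrightarrow> turn R q \<in> S"
  shows "rots p \<subseteq> S"
proof -
  have u: "(-z, y, x) \<in> S" and r: "(x, z, -y) \<in> S" if "(x, y, z) \<in> S" for x y z
    using U[OF that] R[OF that] by simp_all
  have half_u: "(-x, y, -z) \<in> S" if "(x, y, z) \<in> S" for x y z using u[OF u[OF that]] by simp
  have half_r: "(x, -y, -z) \<in> S" if "(x, y, z) \<in> S" for x y z using r[OF r[OF that]] by simp
  have half_f: "(-x, -y, z) \<in> S" if "(x, y, z) \<in> S" for x y z using half_u[OF half_r[OF that]] by simp
  have cyc: "(y, z, x) \<in> S" if "(x, y, z) \<in> S" for x y z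
    using u[OF r[OF that]] by simp
  obtain x y z where p: "p = (x, y, z)" by (cases p)
  have 1: "(x, y, z) \<in> S" "(y, z, x) \<in> S" "(z, x, y) \<in> S"
    using assms(1) cyc p by auto
  have 2: "(x, z, -y) \<in> S" "(y, x, -z) \<in> S" "(z, y, -x) \<in> S"
    using r[OF 1(1)] r[OF 1(2)] r[OF 1(3)] by simp_all
  show ?thesis
    using 1 2 1[THEN half_u] 2[THEN half_u] 1[THEN half_r] 2[THEN half_r] 1[THEN half_f] 2[THEN half_f]
    by (auto simp: p)
qed

section \<open>Conjugating turns by rotations of the whole cube\<close>

lemma turn_opposite [simp]: "turn (opposite X) (turn X p) = p" "turn X (turn (opposite X) p) = p"
  by (cases X; cases p; simp)+

lemma opposite_opposite [simp]: "opposite (opposite X) = X"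
  by (cases X) auto

lemma inj_turn: "inj (turn X)"
  by (metis injI turn_opposite(1))

lemma bij_turn: "bij (turn X)"
  by (metis bij_def inj_turn surjI turn_opposite(2))

lemma inv_turn: "inv (turn X) = turn (opposite X)"
  by (rule inv_unique_comp) (simp_all add: fun_eq_iff)

lemma turn_eq_iff: "turn X p = turn X q \<longleftrightarrow> p = q"
  by (simp add: inj_eq inj_turn)

lemma turn_eq_iff_opposite: "turn X p = q \<longleftrightarrow> p = turn (opposite X) q"
  by (metis turn_opposite)

lemma turn_mem_rots_iff: "turn X q \<in> rots p \<longleftrightarrow> q \<in> rots p"
  using turn_mem_rots[of q p X] turn_mem_rots[of "turn X q" p "opposite X"] by auto

lemma mem_turn_image_iff: "p \<in> turn X ` S \<longleftrightarrow> turn (opposite X) p \<in> S"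
  by (metis image_iff turn_opposite)

lemma turn_turn_turn_turn: "turn X (turn X (turn X (turn X p))) = p"
  by (cases X; cases p; simp)

lemma dot_turn: "dot (turn X p) (turn X q) = dot p q"
  by (cases X; cases p; cases q; simp add: algebra_simps)

lemma dot_turn_normal: "dot (turn X p) (normal X) = dot p (normal X)"
  by (cases X; cases p; simp)

lemma ex_face: "(\<exists>X. P X) \<longleftrightarrow> P U \<or> P D \<or> P F \<or> P B \<or> P R \<or> P L"
  by (metis face.exhaust)

definition turned_face :: "face \<Rightarrow> face \<Rightarrow> face" where
  "turned_face X Y = (SOME Z. normal Z = turn X (normal Y))"

lemma normal_turned_face: "normal (turned_face X Y) = turn X (normal Y)"
proof -
  have "\<exists>Z. normal Z = turn X (normal Y)"
    by (cases X; cases Y) (simp_all add: ex_face)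
  then show ?thesis unfolding turned_face_def by (rule someI_ex)
qed

lemma inj_normal: "inj normal"
proof (rule injI)
  fix X Y assume "normal X = normal Y" then show "X = Y" by (cases X; cases Y; simp)
qed

lemma turn_turned_face: "turn (turned_face X Y) (turn X p) = turn X (turn Y p)"
  using normal_turned_face[of X Y]
  by (cases X; cases Y; cases "turned_face X Y"; cases p; simp)

section \<open>From facelets to cubies, from slices to layers\<close>

definition shrink :: "nat \<Rightarrow> int \<Rightarrow> int" where
  "shrink n t = (if t = int n then int n - 1 else if t = - int n then 1 - int n else t)"

fun cubie :: "nat \<Rightarrow> point \<Rightarrow> point" where
  "cubie n (x, y, z) = (shrink n x, shrink n y, shrink n z)"

lemma shrink_minus: "n \<ge> 1 \<Longrightarrow> shrink n (- t) = - shrink n t"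
  by (auto simp: shrink_def)

lemma cubie_turn: "n \<ge> 1 \<Longrightarrow> cubie n (turn X f) = turn X (cubie n f)"
  by (cases X; cases f) (simp_all add: shrink_minus)

lemma cubie_idem: "n \<ge> 1 \<Longrightarrow> cubie n (cubie n f) = cubie n f"
  by (cases f) (auto simp: shrink_def)

text \<open>The layer is addressed by the cubie coordinate along the axis instead of a slice number.
  This depth is relative to the face, so a rotation of the whole cube changes \<open>X\<close> but
  not \<open>c\<close>.\<close>

definition layer_turn :: "nat \<Rightarrow> face \<Rightarrow> int \<Rightarrow> point \<Rightarrow> point" where
  "layer_turn n X c f =
    (if f \<in> facelets n \<and> dot (cubie n f) (normal X) = c then turn X f else f)"

lemma range_coord: "coord n ` {1..n} = {t. \<bar>t\<bar> < int n \<and> odd (t + int n)}"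
proof (intro equalityI subsetI)
  fix t assume "t \<in> {t. \<bar>t\<bar> < int n \<and> odd (t + int n)}"
  then have t: "\<bar>t\<bar> < int n" "odd (t + int n)" by auto
  then obtain m where m: "t + int n = 2 * m + 1" using oddE by blast
  have "t = coord n (nat (m + 1))" "nat (m + 1) \<in> {1..n}" using t m by (auto simp: coord_def)
  then show "t \<in> coord n ` {1..n}" by blast
qed (auto simp: coord_def)

locale even_cube =
  fixes n :: nat
  assumes even_n: "even n" and n_ge_2: "n \<ge> 2"
begin

lemma coord_range_iff: "(\<exists>k\<in>{1..n}. t = coord n k) \<longleftrightarrow> \<bar>t\<bar> < int n \<and> odd t"
proof -
  have "(\<exists>k\<in>{1..n}. t = coord n k) \<longleftrightarrow> t \<in> coord n ` {1..n}" by auto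
  then show ?thesis unfolding range_coord using even_n by simp
qed

lemma mem_facelets_iff:
  "(x, y, z) \<in> facelets n \<longleftrightarrow>
    (\<bar>x\<bar> = int n \<and> odd y \<and> odd z \<and> \<bar>y\<bar> < int n \<and> \<bar>z\<bar> < int n) \<or>
    (\<bar>y\<bar> = int n \<and> odd x \<and> odd z \<and> \<bar>x\<bar> < int n \<and> \<bar>z\<bar> < int n) \<or>
    (\<bar>z\<bar> = int n \<and> odd x \<and> odd y \<and> \<bar>x\<bar> < int n \<and> \<bar>y\<bar> < int n)" (is "_ \<longleftrightarrow> ?rhs")
proof
  have ok: "odd (coord n k)" "\<bar>coord n k\<bar> < int n" if "k \<in> {1..n}" for k
    using coord_range_iff that by blast+
  assume "(x, y, z) \<in> facelets n"
  then obtain X r c where *: "(x, y, z) = facelet n X r c" "r \<in> {1..n}" "c \<in> {1..n}"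
    by (auto simp: facelets_def)
  show ?rhs
    using *(1) ok[OF *(2)] ok[OF *(3)] by (cases X) simp_all
next
  have ex: "\<exists>k\<in>{1..n}. t = coord n k" "\<exists>k\<in>{1..n}. t = - coord n k" if "odd t" "\<bar>t\<bar> < int n" for t
    using coord_range_iff[of t] coord_range_iff[of "- t"] that
    by (simp, metis abs_minus_cancel add.inverse_inverse even_minus)
  have mem: "facelet n X r c \<in> facelets n" if "r \<in> {1..n}" "c \<in> {1..n}" for X r c
    using that by (auto simp: facelets_def)
  assume ?rhs
  then consider "\<bar>x\<bar> = int n" "odd y" "odd z" "\<bar>y\<bar> < int n" "\<bar>z\<bar> < int n"
    | "\<bar>y\<bar> = int n" "odd x" "odd z" "\<bar>x\<bar> < int n" "\<bar>z\<bar> < int n"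
    | "\<bar>z\<bar> = int n" "odd x" "odd y" "\<bar>x\<bar> < int n" "\<bar>y\<bar> < int n" by blast
  then show "(x, y, z) \<in> facelets n"
  proof cases
    case 1
    obtain r c c' where rc: "r \<in> {1..n}" "y = - coord n r" "c \<in> {1..n}" "z = coord n c"
      "c' \<in> {1..n}" "z = - coord n c'"
      using ex(2)[OF 1(2,4)] ex[OF 1(3,5)] by blast
    have "x = int n \<or> x = - int n" using 1 by linarith
    then show ?thesis
    proof
      assume "x = int n"
      then have "(x, y, z) = facelet n R r c'" unfolding facelet.simps rc(2) by (simp add: rc(6))
      then show ?thesis using mem rc(1,5) by metis
    next
      assume "x = - int n"
      then have "(x, y, z) = facelet n L r c" unfolding facelet.simps rc(2) by (simp add: rc(4))
      then show ?thesis using mem rc(1,3) by metis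
    qed
  next
    case 2
    obtain r r' c where rc: "r \<in> {1..n}" "z = coord n r" "r' \<in> {1..n}" "z = - coord n r'"
      "c \<in> {1..n}" "x = coord n c"
      using ex(1)[OF 2(2,4)] ex[OF 2(3,5)] by blast
    have "y = int n \<or> y = - int n" using 2 by linarith
    then show ?thesis
    proof
      assume "y = int n"
      then have "(x, y, z) = facelet n U r c" unfolding facelet.simps rc(6) by (simp add: rc(2))
      then show ?thesis using mem rc(1,5) by metis
    next
      assume "y = - int n"
      then have "(x, y, z) = facelet n D r' c" unfolding facelet.simps rc(6) by (simp add: rc(4))
      then show ?thesis using mem rc(3,5) by metis
    qed
  next
    case 3
    obtain r c c' where rc: "r \<in> {1..n}" "y = - coord n r" "c \<in> {1..n}" "x = coord n c"
      "c' \<in> {1..n}" "x = - coord n c'"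
      using ex(2)[OF 3(3,5)] ex[OF 3(2,4)] by blast
    have "z = int n \<or> z = - int n" using 3 by linarith
    then show ?thesis
    proof
      assume "z = int n"
      then have "(x, y, z) = facelet n F r c" unfolding facelet.simps rc(2) by (simp add: rc(4))
      then show ?thesis using mem rc(1,3) by metis
    next
      assume "z = - int n"
      then have "(x, y, z) = facelet n B r c'" unfolding facelet.simps rc(2) by (simp add: rc(6))
      then show ?thesis using mem rc(1,5) by metis
    qed
  qed
qed

lemma turn_mem_facelets: "turn X f \<in> facelets n \<longleftrightarrow> f \<in> facelets n"
  by (cases X; cases f; simp add: mem_facelets_iff; blast)

text \<open>A coordinate of a facelet is odd or equals \<open>n\<close> or \<open>-n\<close>. The
  half-open slab has even end points, so its only odd value is the middle; its upper end is
  \<open>n\<close> exactly for \<open>k = 1\<close>, and there \<open>shrink\<close> moves it to the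
  middle as well.\<close>

lemma slice_iff_cubie:
  assumes "f \<in> facelets n" "1 \<le> k" "2 * k \<le> n"
  shows "f \<in> slice n X k \<longleftrightarrow> dot (cubie n f) (normal X) = int n + 1 - 2 * int k"
proof -
  obtain x y z where f: "f = (x, y, z)" by (cases f)
  have *: "int n - 2 * int k < t \<and> t \<le> int n - 2 * int k + 2 \<longleftrightarrow> shrink n t = int n + 1 - 2 * int k"
    if "odd t \<and> \<bar>t\<bar> < int n \<or> \<bar>t\<bar> = int n" for t
  proof (cases "\<bar>t\<bar> = int n")
    case True
    then show ?thesis using assms(2,3) by (auto simp: shrink_def abs_if split: if_splits)
  next
    case False
    then have "odd t" "shrink n t = t" using that by (auto simp: shrink_def)
    moreover have "odd (int n + 1 - 2 * int k)" using even_n by simp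
    ultimately show ?thesis by presburger
  qed
  have "n \<ge> 1" using n_ge_2 by simp
  have "odd t \<and> \<bar>t\<bar> < int n \<or> \<bar>t\<bar> = int n" if "t \<in> {x, y, z, -x, -y, -z}" for t
    using assms(1) that by (auto simp: f mem_facelets_iff)
  note ** = *[OF this]
  show ?thesis
    using **[of x] **[of y] **[of z] **[of "-x"] **[of "-y"] **[of "-z"] \<open>n \<ge> 1\<close>
    by (cases X) (simp_all add: f slice_def shrink_minus)
qed

lemma move_eq_layer_turn:
  assumes "1 \<le> k" "2 * k \<le> n"
  shows "move n X k = layer_turn n X (int n + 1 - 2 * int k)"
  using slice_iff_cubie[OF _ assms] by (auto simp: fun_eq_iff move_def layer_turn_def)

section \<open>The group of reachable states\<close>

definition layers :: "int set" where
  "layers = {c. odd c \<and> 0 < c \<and> c < int n}"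

lemma finite_layers: "finite layers"
  by (rule finite_subset[of _ "{0..int n}"]) (auto simp: layers_def)

lemma layersE:
  assumes "c \<in> layers"
  obtains k where "1 \<le> k" "2 * k \<le> n" "c = int n + 1 - 2 * int k"
proof -
  have "even (int n + 1 - c)" using assms even_n by (auto simp: layers_def)
  then obtain m where m: "int n + 1 - c = 2 * m" using evenE by blast
  then have "1 \<le> m" "2 * m \<le> int n" using assms by (auto simp: layers_def)
  then show ?thesis using that[of "nat m"] m by auto
qed

lemma layer_mem_layers:
  assumes "1 \<le> k" "2 * k \<le> n"
  shows "int n + 1 - 2 * int k \<in> layers"
  using assms even_n by (auto simp: layers_def)

lemma layer_turn_comp_reachable:
  assumes "c \<in> layers" "g \<in> reachable n"
  shows "layer_turn n X c \<circ> g \<in> reachable n"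
  using assms by (metis layersE move_eq_layer_turn reachable.step)

lemma reachable_induct [consumes 1, case_names id layer_turn]:
  assumes "g \<in> reachable n" "P id"
    and "\<And>g X c. g \<in> reachable n \<Longrightarrow> c \<in> layers \<Longrightarrow> P g \<Longrightarrow> P (layer_turn n X c \<circ> g)"
  shows "P g"
  using assms(1)
proof induction
  case (step g k X)
  then show ?case using assms(3) layer_mem_layers move_eq_layer_turn by metis
qed (rule assms(2))

lemma layer_turn_reachable: "c \<in> layers \<Longrightarrow> layer_turn n X c \<in> reachable n"
  using layer_turn_comp_reachable[OF _ reachable.solved] by simp

lemma reachable_comp: "g \<in> reachable n \<Longrightarrow> h \<in> reachable n \<Longrightarrow> g \<circ> h \<in> reachable n"
  by (induction rule: reachable_induct) (simp_all add: comp_assoc layer_turn_comp_reachable)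

lemma cubie_turn': "cubie n (turn X f) = turn X (cubie n f)"
  using n_ge_2 by (intro cubie_turn) simp

lemma layer_turn_four:
  "layer_turn n X c \<circ> layer_turn n X c \<circ> layer_turn n X c \<circ> layer_turn n X c = id"
  by (auto simp: fun_eq_iff layer_turn_def turn_mem_facelets cubie_turn' dot_turn_normal turn_turn_turn_turn)

text \<open>Inverse moves are not among the generators, but a layer turn has order 4, so three
  further turns undo it.\<close>

lemma reachable_inverse: "g \<in> reachable n \<Longrightarrow> \<exists>h\<in>reachable n. h \<circ> g = id \<and> g \<circ> h = id"
proof (induction rule: reachable_induct)
  case id
  then show ?case using reachable.solved by (intro bexI[of _ id]) auto
next
  case (layer_turn g X c)
  then obtain h where h: "h \<in> reachable n" "h \<circ> g = id" "g \<circ> h = id" by blast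
  let ?t = "layer_turn n X c"
  have t: "?t \<in> reachable n" using layer_turn.hyps layer_turn_reachable by blast
  have four: "?t (?t (?t (?t f))) = f" for f using layer_turn_four[of X c] by (metis comp_apply id_apply)
  have "h \<circ> (?t \<circ> ?t \<circ> ?t) \<in> reachable n" using h t by (intro reachable_comp) auto
  moreover have "h \<circ> (?t \<circ> ?t \<circ> ?t) \<circ> (?t \<circ> g) = id" "(?t \<circ> g) \<circ> (h \<circ> (?t \<circ> ?t \<circ> ?t)) = id"
    using h(2,3) four by (metis (no_types, lifting) comp_apply id_apply ext)+
  ultimately show ?case by blast
qed

lemma reachable_bij: "g \<in> reachable n \<Longrightarrow> bij g"
  using reachable_inverse o_bij by metis

lemma reachable_inv: "g \<in> reachable n \<Longrightarrow> inv g \<in> reachable n"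
  using reachable_inverse inv_unique_comp by metis

lemma reachable_outside: "g \<in> reachable n \<Longrightarrow> f \<notin> facelets n \<Longrightarrow> g f = f"
  by (induction arbitrary: f rule: reachable_induct) (auto simp: layer_turn_def)

lemma reachable_mem_facelets: "g \<in> reachable n \<Longrightarrow> g f \<in> facelets n \<longleftrightarrow> f \<in> facelets n"
  by (induction arbitrary: f rule: reachable_induct) (auto simp: layer_turn_def turn_mem_facelets)

lemma conj_turn_layer_turn:
  "turn X \<circ> layer_turn n Y c = layer_turn n (turned_face X Y) c \<circ> turn X"
  by (auto simp: fun_eq_iff layer_turn_def turn_mem_facelets cubie_turn' normal_turned_face
      dot_turn turn_turned_face)

text \<open>A rotation of the whole cube carries the layer under \<open>Y\<close> to the layer of
  the same depth under \<open>turned_face X Y\<close>; it therefore conjugates generators to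
  generators.\<close>

lemma conj_turn_reachable: "g \<in> reachable n \<Longrightarrow> turn X \<circ> g \<circ> turn (opposite X) \<in> reachable n"
proof (induction rule: reachable_induct)
  case id
  have "turn X \<circ> id \<circ> turn (opposite X) = id" by (simp add: fun_eq_iff)
  then show ?case using reachable.solved by metis
next
  case (layer_turn g Y c)
  have "turn X \<circ> (layer_turn n Y c \<circ> g) \<circ> turn (opposite X) =
    layer_turn n (turned_face X Y) c \<circ> (turn X \<circ> g \<circ> turn (opposite X))"
    using conj_turn_layer_turn[of X Y c] by (simp add: comp_assoc[symmetric])
  then show ?case using layer_turn layer_turn_comp_reachable by metis
qed

end

section \<open>Three-cycles in a single orbit\<close>

context even_cube
begin

abbreviation outer :: int where
  "outer \<equiv> int n - 1"

lemma outer_mem_layers: "outer \<in> layers"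
  using even_n n_ge_2 by (auto simp: layers_def)

text \<open>The common support is the cubie \<open>(a, outer, b)\<close>: turning U takes it to
  \<open>(-b, outer, a)\<close>, inside the layer of \<open>l\<close>, and turning L then takes it
  to \<open>(-b, -a, outer)\<close>, out of the U layer, so that undoing the U turn leaves it there.
  Its image under the R turn and this last position are the other two places of the cycle.\<close>

lemma three_cubie_commutator:
  assumes "a \<in> layers" "b \<in> layers"
  defines "P \<equiv> {f \<in> facelets n. cubie n f = (a, outer, b)}"
  shows "\<exists>t\<in>reachable n.
    (\<forall>f\<in>P. t f = turn R f \<and> t (turn R f) = turn L (turn U f) \<and> t (turn L (turn U f)) = f) \<and>
    (\<forall>f. f \<notin> P \<and> f \<notin> turn R ` P \<and> f \<notin> (\<lambda>f. turn L (turn U f)) ` P \<longrightarrow> t f = f)"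
proof -
  define u where "u = layer_turn n U outer"
  \<comment> \<open>The inverse of \<open>u\<close> turns the U layer like D; seen from D this layer
    has negative depth, so it is no generator and is written out.\<close>
  define u' where "u' = (\<lambda>f. if f \<in> facelets n \<and> dot (cubie n f) (normal U) = outer then turn D f else f)"
  define l where "l = layer_turn n L b"
  define g where "g = layer_turn n R a"
  define h where "h = inv u \<circ> l \<circ> u"
  have pos: "a > 0" "b > 0" "outer > 0" using assms(1,2) n_ge_2 by (auto simp: layers_def)
  have reach: "u \<in> reachable n" "l \<in> reachable n" "g \<in> reachable n"
    using layer_turn_reachable assms(1,2) outer_mem_layers by (auto simp: u_def l_def g_def)
  then have hreach: "h \<in> reachable n"
    unfolding h_def by (intro reachable_comp reachable_inv)
  have turn_UD: "turn U (turn D f) = f" "turn D (turn U f) = f" for f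
    using turn_opposite[of U f] by simp_all
  have dot_D: "dot (turn D f) (normal U) = dot f (normal U)" for f
    using dot_turn_normal[of D f] by (cases f) simp
  have inv_u: "inv u = u'"
  proof (rule inv_unique_comp)
    show "u \<circ> u' = id" "u' \<circ> u = id"
      by (auto simp: fun_eq_iff u_def u'_def layer_turn_def turn_mem_facelets cubie_turn'
          dot_D dot_turn_normal turn_UD simp del: normal.simps turn.simps)
  qed
  have nonzero: "t \<noteq> 0" if "(x, y, z) \<in> facelets n" "t \<in> {x, y, z}" for x y z t
    using that n_ge_2 by (auto simp: mem_facelets_iff)
  have g_moves: "g f \<noteq> f \<longleftrightarrow> f \<in> facelets n \<and> fst (cubie n f) = a" for f
    using nonzero by (cases f) (auto simp: g_def layer_turn_def)
  have g_P: "g f = turn R f" if "f \<in> P" for f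
    using that by (cases f) (auto simp: g_def layer_turn_def P_def)
  have h_P: "h f = turn L (turn U f)" if "f \<in> P" for f
  proof -
    have f: "f \<in> facelets n" "cubie n f = (a, outer, b)" using that by (auto simp: P_def)
    then have "u f = turn U f" by (simp add: u_def layer_turn_def)
    moreover have "l (turn U f) = turn L (turn U f)"
      using f by (simp add: l_def layer_turn_def turn_mem_facelets cubie_turn')
    moreover have "u' (turn L (turn U f)) = turn L (turn U f)"
      using f pos by (simp add: u'_def cubie_turn')
    ultimately show ?thesis by (simp add: h_def inv_u)
  qed
  \<comment> \<open>A cubie with \<open>x = a > 0\<close> outside the U layer is met by neither
    \<open>u\<close> nor \<open>l\<close>. One inside the U layer, at depth \<open>z\<close> towards
    F, is brought by \<open>u\<close> to \<open>x = -z\<close>, which is the layer of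
    \<open>l\<close> only for \<open>z = b\<close>.\<close>
  have h_fixes: "h f = f" if "f \<in> facelets n" "fst (cubie n f) = a" "f \<notin> P" for f
  proof -
    obtain y z where yz: "cubie n f = (a, y, z)" by (metis prod.collapse \<open>fst (cubie n f) = a\<close>)
    show ?thesis
    proof (cases "y = outer")
      case True
      then have "z \<noteq> b" using that yz by (auto simp: P_def)
      then have "l (u f) = u f"
        using that yz True by (simp add: u_def l_def layer_turn_def turn_mem_facelets cubie_turn')
      then show ?thesis using reach by (simp add: h_def bij_is_inj reachable_bij)
    next
      case False
      then have "u f = f" "l f = f" "u' f = f"
        using yz pos by (simp_all add: u_def l_def u'_def layer_turn_def)
      then show ?thesis by (simp add: h_def inv_u)
    qed
  qed
  have P_iff: "f \<in> P \<longleftrightarrow> g f \<noteq> f \<and> h f \<noteq> f" for f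
  proof
    assume f: "f \<in> P"
    have "cubie n (turn L (turn U f)) \<noteq> cubie n f" using f pos by (simp add: P_def cubie_turn')
    then show "g f \<noteq> f \<and> h f \<noteq> f" using g_moves f h_P by (auto simp: P_def)
  qed (use g_moves h_fixes in blast)
  have gP: "g f \<notin> P" if "f \<in> P" for f
    using that pos by (auto simp: g_P P_def cubie_turn')
  have hP: "h f \<notin> P" if "f \<in> P" for f
    using that pos by (auto simp: h_P P_def cubie_turn')
  note comm = commutator_small_overlap[OF reachable_bij reachable_bij P_iff gP hP, OF reach(3) hreach]
  have im: "g ` P = turn R ` P" "h ` P = (\<lambda>f. turn L (turn U f)) ` P"
    using g_P h_P by (auto simp: image_def)
  have "g \<circ> h \<circ> inv g \<circ> inv h \<in> reachable n"
    using reach hreach by (intro reachable_comp reachable_inv)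
  then show ?thesis
    using comm g_P h_P im by (intro bexI[of _ "g \<circ> h \<circ> inv g \<circ> inv h"]) (auto simp del: comp_apply)
qed

end

text \<open>The key of a facelet stands for the cubie that carries it: for corners and edges it is the
  position of the cubie, for centers the facelet itself.\<close>

locale keyed_orbit = even_cube +
  fixes key :: "point \<Rightarrow> point" and k0 :: point and a b :: int
  assumes key_turn: "key (turn X f) = turn X (key f)"
    and cubie_key: "cubie n (key f) = cubie n f"
    and a_layer: "a \<in> layers" and b_layer: "b \<in> layers"
    and key_base: "f \<in> facelets n \<Longrightarrow> key f = k0 \<longleftrightarrow> cubie n f = (a, int n - 1, b)"
begin

definition block :: "point set" where
  "block = {f \<in> facelets n. key f \<in> rots k0}"

text \<open>Only keys are prescribed: stickers of one cubie may be exchanged among each other, so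
  orientations remain free. Outside the block, on the other hand, the state has to be the identity
  pointwise; this is what lets different orbits be treated separately.\<close>

definition lifts :: "(point \<Rightarrow> point) set" where
  "lifts = {\<tau>. \<tau> permutes rots k0 \<and>
    (\<exists>g\<in>reachable n. (\<forall>f. f \<notin> block \<longrightarrow> g f = f) \<and> (\<forall>f\<in>block. key (g f) = \<tau> (key f)))}"

lemma turn_mem_block_iff: "turn X f \<in> block \<longleftrightarrow> f \<in> block"
  by (simp add: block_def turn_mem_facelets key_turn turn_mem_rots_iff)

lemma lifts_maps_block:
  assumes "\<tau> permutes rots k0" "g \<in> reachable n" "\<forall>f\<in>block. key (g f) = \<tau> (key f)" "f \<in> block"
  shows "g f \<in> block"
  using assms by (auto simp: block_def reachable_mem_facelets permutes_in_image)

sublocale permutation_group lifts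
proof
  show "id \<in> lifts" by (auto simp: lifts_def intro!: bexI[of _ id] reachable.solved)
next
  fix s t assume "s \<in> lifts" "t \<in> lifts"
  then obtain g h where st: "s permutes rots k0" "t permutes rots k0"
    and g: "g \<in> reachable n" "\<forall>f. f \<notin> block \<longrightarrow> g f = f" "\<forall>f\<in>block. key (g f) = s (key f)"
    and h: "h \<in> reachable n" "\<forall>f. f \<notin> block \<longrightarrow> h f = f" "\<forall>f\<in>block. key (h f) = t (key f)"
    by (auto simp: lifts_def)
  have "\<forall>f\<in>block. h f \<in> block" using lifts_maps_block st h by blast
  then show "s \<circ> t \<in> lifts"
    unfolding lifts_def using st g h reachable_comp
    by (auto intro!: permutes_compose bexI[of _ "g \<circ> h"])
next
  fix s assume "s \<in> lifts"
  then obtain g where s: "s permutes rots k0"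
    and g: "g \<in> reachable n" "\<forall>f. f \<notin> block \<longrightarrow> g f = f" "\<forall>f\<in>block. key (g f) = s (key f)"
    by (auto simp: lifts_def)
  have gi: "g (inv g f) = f" "inv g (g f) = f" for f
    using reachable_bij[OF g(1)] by (simp_all add: bij_is_surj surj_f_inv_f bij_is_inj)
  have "inv g f = f" if "f \<notin> block" for f using that g gi by metis
  moreover have "key (inv g f) = inv s (key f)" if "f \<in> block" for f
  proof -
    have "inv g f \<in> block" using that g gi by metis
    then have "key f = s (key (inv g f))" using g gi by metis
    then show ?thesis using s by (simp add: permutes_inverses)
  qed
  ultimately show "inv s \<in> lifts"
    unfolding lifts_def using s g reachable_inv permutes_inv by blast
next
  fix s assume "s \<in> lifts"
  then show "bij s" by (auto simp: lifts_def permutes_bij)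
qed

lemma conj_turn_lifts:
  assumes "s \<in> lifts"
  shows "turn X \<circ> s \<circ> turn (opposite X) \<in> lifts"
proof -
  obtain g where s: "s permutes rots k0"
    and g: "g \<in> reachable n" "\<forall>f. f \<notin> block \<longrightarrow> g f = f" "\<forall>f\<in>block. key (g f) = s (key f)"
    using assms by (auto simp: lifts_def)
  let ?s = "turn X \<circ> s \<circ> turn (opposite X)" and ?g = "turn X \<circ> g \<circ> turn (opposite X)"
  have "bij ?s" using permutes_bij[OF s] bij_turn by (intro bij_comp)
  moreover have "?s p = p" if "p \<notin> rots k0" for p
    using s that by (simp add: permutes_not_in turn_mem_rots_iff)
  ultimately have "?s permutes rots k0"
    unfolding permutes_def bij_iff by blast
  moreover have "?g \<in> reachable n" using g conj_turn_reachable by blast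
  moreover have "?g f = f" if "f \<notin> block" for f using that g by (simp add: turn_mem_block_iff)
  moreover have "key (?g f) = ?s (key f)" if "f \<in> block" for f
    using that g by (simp add: turn_mem_block_iff key_turn)
  ultimately show ?thesis unfolding lifts_def by blast
qed

lemma linked_turn:
  assumes "linked lifts p q"
  shows "linked lifts (turn X p) (turn X q)"
proof (cases "p = q")
  case False
  then obtain r where r: "r \<noteq> p" "r \<noteq> q" "cyc3 p q r \<in> lifts" using assms by (auto simp: linked_def)
  have "cyc3 (turn X p) (turn X q) (turn X r) \<in> lifts"
    using conj_turn_lifts[OF r(3), of X] conj_cyc3[OF bij_turn] by (metis inv_turn)
  then show ?thesis using r False unfolding linked_def by (metis turn_eq_iff)
qed (simp add: linked_refl)

text \<open>The commutator runs one 3-cycle through each facelet of the base cubie; on keys these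
  all become the same 3-cycle. The locale assumption \<open>key_base\<close> identifies the overlap
  of the commutator with the facelets of key \<open>k0\<close>.\<close>

lemma base_cyc3:
  "cyc3 k0 (turn R k0) (turn L (turn U k0)) \<in> lifts"
  "k0 \<noteq> turn R k0" "turn R k0 \<noteq> turn L (turn U k0)" "k0 \<noteq> turn L (turn U k0)"
proof -
  let ?P = "{f \<in> facelets n. cubie n f = (a, int n - 1, b)}"
  let ?c = "cyc3 k0 (turn R k0) (turn L (turn U k0))"
  obtain t where t: "t \<in> reachable n"
    and t123: "\<forall>f\<in>?P. t f = turn R f \<and> t (turn R f) = turn L (turn U f) \<and> t (turn L (turn U f)) = f"
    and t4': "\<forall>f. f \<notin> ?P \<and> f \<notin> turn R ` ?P \<and> f \<notin> (\<lambda>f. turn L (turn U f)) ` ?P \<longrightarrow> t f = f"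
    using three_cubie_commutator[OF a_layer b_layer] by blast
  have t1: "t f = turn R f" and t2: "t (turn R f) = turn L (turn U f)"
    and t3: "t (turn L (turn U f)) = f" if "f \<in> ?P" for f
    using t123 that by blast+
  have t4: "t f = f" if "f \<notin> ?P" "f \<notin> turn R ` ?P" "f \<notin> (\<lambda>f. turn L (turn U f)) ` ?P" for f
    using t4' that by blast
  have pos: "a > 0" "b > 0" "int n > 1" using a_layer b_layer n_ge_2 by (auto simp: layers_def)
  \<comment> \<open>The U sticker of the base cubie is used as a sample: its key is
    \<open>k0\<close>, which reveals the cubie of \<open>k0\<close>.\<close>
  have "(a, int n, b) \<in> facelets n" "cubie n (a, int n, b) = (a, int n - 1, b)"
    using a_layer b_layer by (auto simp: mem_facelets_iff layers_def shrink_def)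
  then have ck: "cubie n k0 = (a, int n - 1, b)"
    using key_base cubie_key by metis
  have c: "cubie n (turn R k0) = (a, b, 1 - int n)" "cubie n (turn L (turn U k0)) = (- b, - a, int n - 1)"
    by (simp_all add: cubie_turn' ck)
  show dist: "k0 \<noteq> turn R k0" "turn R k0 \<noteq> turn L (turn U k0)" "k0 \<noteq> turn L (turn U k0)"
    using ck c pos by auto
  have in_rots: "k0 \<in> rots k0" "turn R k0 \<in> rots k0" "turn L (turn U k0) \<in> rots k0"
    by (simp_all add: turn_mem_rots_iff self_mem_rots)
  have "?c permutes rots k0" using dist in_rots by (intro cyc3_permutes)
  moreover have P: "f \<in> ?P \<longleftrightarrow> f \<in> facelets n \<and> key f = k0" for f using key_base[of f] by auto
  have PR: "f \<in> turn R ` ?P \<longleftrightarrow> f \<in> facelets n \<and> key f = turn R k0" for f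
  proof -
    have "f \<in> turn R ` ?P \<longleftrightarrow> turn L f \<in> ?P" by (simp only: mem_turn_image_iff opposite.simps)
    also have "\<dots> \<longleftrightarrow> f \<in> facelets n \<and> key f = turn R k0"
      unfolding P using turn_eq_iff_opposite[of L "key f" k0] by (simp add: turn_mem_facelets key_turn)
    finally show ?thesis .
  qed
  have PL: "f \<in> (\<lambda>f. turn L (turn U f)) ` ?P \<longleftrightarrow> f \<in> facelets n \<and> key f = turn L (turn U k0)" for f
  proof -
    have "f \<in> (\<lambda>f. turn L (turn U f)) ` ?P \<longleftrightarrow> turn D (turn R f) \<in> ?P"
      by (simp only: image_image[of "turn L" "turn U", symmetric] mem_turn_image_iff opposite.simps)
    also have "\<dots> \<longleftrightarrow> f \<in> facelets n \<and> key f = turn L (turn U k0)"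
      unfolding P using turn_eq_iff_opposite[of R "key f"] turn_eq_iff_opposite[of D _ k0]
      by (simp add: turn_mem_facelets key_turn)
    finally show ?thesis .
  qed
  have "t f = f" if "f \<notin> block" for f
  proof -
    have "\<not> (f \<in> facelets n \<and> key f = k)" if "k \<in> rots k0" for k
      using \<open>f \<notin> block\<close> that by (auto simp: block_def)
    then show ?thesis by (intro t4) (simp_all only: P PR PL in_rots simp_thms)
  qed
  moreover have "key (t f) = ?c (key f)" if "f \<in> block" for f
  proof -
    have f: "f \<in> facelets n" using that by (simp add: block_def)
    consider "f \<in> ?P" | f' where "f' \<in> ?P" "f = turn R f'" | f' where "f' \<in> ?P" "f = turn L (turn U f')"
      | "f \<notin> ?P" "f \<notin> turn R ` ?P" "f \<notin> (\<lambda>f. turn L (turn U f)) ` ?P" by blast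
    then show ?thesis
    proof cases
      case 1
      then have "key f = k0" using P[of f] by simp
      then show ?thesis using t1[OF 1] dist by (simp add: key_turn cyc3_def)
    next
      case 2
      then have "key f' = k0" using P[of f'] by simp
      then show ?thesis using t2[OF 2(1)] 2(2) dist by (simp add: key_turn cyc3_def)
    next
      case 3
      then have "key f' = k0" using P[of f'] by simp
      then show ?thesis using t3[OF 3(1)] 3(2) dist by (simp add: key_turn cyc3_def)
    next
      case 4
      then have "key f \<notin> {k0, turn R k0, turn L (turn U k0)}" using P[of f] PR[of f] PL[of f] f by simp
      then show ?thesis using t4[OF 4] by (simp add: cyc3_def)
    qed
  qed
  ultimately show "?c \<in> lifts" unfolding lifts_def using t by blast
qed

lemma all_linked:
  assumes "p \<in> rots k0" "q \<in> rots k0"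
  shows "linked lifts p q"
proof -
  have R: "linked lifts k0 (turn R k0)"
    using base_cyc3 unfolding linked_def by metis
  have "linked lifts k0 (turn L (turn U k0))"
  proof -
    have "cyc3 (turn L (turn U k0)) k0 (turn R k0) \<in> lifts" using base_cyc3 by (metis cyc3_rotate)
    then have "linked lifts (turn L (turn U k0)) k0" using base_cyc3 unfolding linked_def by metis
    then show ?thesis by (rule linked_sym)
  qed
  \<comment> \<open>Rotating this link by R cancels the L turn and gives a link from
    \<open>turn R k0\<close> to \<open>turn U k0\<close>, which the first link extends back to
    \<open>k0\<close>.\<close>
  from linked_turn[OF this, of R] have U: "linked lifts k0 (turn U k0)"
    using R linked_trans turn_opposite(2)[of R "turn U k0"] by (metis opposite.simps(5))
  have "rots k0 \<subseteq> {p. linked lifts k0 p}"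
    by (rule rots_subset) (use R U linked_refl linked_trans linked_turn in blast)+
  then show ?thesis using assms linked_sym linked_trans by blast
qed

theorem even_permutation_lifts:
  assumes "\<tau> permutes rots k0" "sign \<tau> = 1"
  shows "\<tau> \<in> lifts"
  using finite_rots assms one_mem comp_mem
proof (rule even_permutation_in_cyc3_closure)
  fix p q r assume *: "p \<in> rots k0" "q \<in> rots k0" "r \<in> rots k0" "p \<noteq> q" "q \<noteq> r" "p \<noteq> r"
  show "cyc3 p q r \<in> lifts"
    by (rule cyc3_mem_if_linked[OF all_linked *]) (simp_all add: lifts_def)
qed

end

section \<open>Parity\<close>

definition restrict_to :: "('a \<Rightarrow> 'a) \<Rightarrow> 'a set \<Rightarrow> 'a \<Rightarrow> 'a" where
  "restrict_to t S p = (if p \<in> S then t p else p)"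

lemma restrict_to_Un:
  assumes "\<And>p. p \<in> S' \<Longrightarrow> t p \<in> S'" "S \<inter> S' = {}"
  shows "restrict_to t (S \<union> S') = restrict_to t S \<circ> restrict_to t S'"
  using assms by (auto simp: restrict_to_def fun_eq_iff)

lemma inj_restrict_to:
  assumes "inj t" "\<And>p. t p \<in> S \<longleftrightarrow> p \<in> S"
  shows "inj (restrict_to t S)"
proof (rule injI)
  fix p q assume *: "restrict_to t S p = restrict_to t S q"
  moreover have "p \<in> S \<longleftrightarrow> q \<in> S" using * assms(2) by (metis restrict_to_def)
  ultimately show "p = q" using assms(1) by (auto simp: restrict_to_def inj_eq split: if_splits)
qed

lemma restrict_to_empty [simp]: "restrict_to t {} = id"
  by (simp add: restrict_to_def fun_eq_iff)

lemma four_cycle: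
  assumes "distinct [p, t p, t (t p), t (t (t p))]" "t (t (t (t p))) = p"
  defines "S \<equiv> {p, t p, t (t p), t (t (t p))}"
  shows "restrict_to t S permutes S" "sign (restrict_to t S) = -1"
proof -
  let ?q = "t p" and ?r = "t (t p)" and ?s = "t (t (t p))"
  have eq: "restrict_to t S = transpose p ?q \<circ> transpose ?q ?r \<circ> transpose ?r ?s"
    using assms(1,2) by (auto simp: restrict_to_def S_def transpose_def fun_eq_iff)
  show "restrict_to t S permutes S"
    unfolding eq by (intro permutes_compose permutes_swap_id) (auto simp: S_def)
  show "sign (restrict_to t S) = -1"
    unfolding eq using assms(1)
    by (simp add: sign_compose permutation_compose permutation_swap_id sign_swap_id)
qed

definition ring :: "point \<Rightarrow> point set" where
  "ring p = {p, turn U p, turn U (turn U p), turn U (turn U (turn U p))}"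

lemma turn_U_mem_ring: "q \<in> ring p \<Longrightarrow> turn U q \<in> ring p"
  by (auto simp: ring_def turn_turn_turn_turn simp del: turn.simps)

lemma ring_four_cycle:
  assumes "fst p \<noteq> 0"
  shows "restrict_to (turn U) (ring p) permutes ring p" "sign (restrict_to (turn U) (ring p)) = -1"
proof -
  have "distinct [p, turn U p, turn U (turn U p), turn U (turn U (turn U p))]"
    using assms by (cases p) auto
  note four_cycle[OF this turn_turn_turn_turn]
  then show "restrict_to (turn U) (ring p) permutes ring p" "sign (restrict_to (turn U) (ring p)) = -1"
    by (simp_all only: ring_def)
qed

definition parity :: "bool \<Rightarrow> int" where
  "parity P = (if P then -1 else 1)"

lemma sign_ring_if:
  assumes "fst p \<noteq> 0"
  shows "sign (restrict_to (turn U) (if P then ring p else {})) = parity P"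
    and "permutation (restrict_to (turn U) (if P then ring p else {}))"
proof -
  have "finite (ring p)" by (simp add: ring_def)
  then show "sign (restrict_to (turn U) (if P then ring p else {})) = parity P"
    "permutation (restrict_to (turn U) (if P then ring p else {}))"
    using ring_four_cycle[OF assms] permutes_imp_permutation by (auto simp: parity_def)
qed

text \<open>If exactly two of the coordinates agree, two of the rings lie at the same height but are
  mirror images of each other, hence still disjoint. Only for three equal coordinates, the case of
  the corners, do they coincide.\<close>

lemma sign_three_rings:
  assumes "x > 0" "y > 0" "z > 0" "\<not> (x = y \<and> y = z)"
    and "S = (if P then ring (z, x, y) else {}) \<union> ((if Q then ring (x, y, z) else {}) \<union>
      (if W then ring (y, z, x) else {}))"
  shows "sign (restrict_to (turn U) S) = parity P * parity Q * parity W"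
proof -
  let ?A = "if P then ring (z, x, y) else {}" and ?B = "if Q then ring (x, y, z) else {}"
  let ?C = "if W then ring (y, z, x) else {}"
  have "ring (z, x, y) \<inter> ring (x, y, z) = {}" "ring (z, x, y) \<inter> ring (y, z, x) = {}"
    "ring (x, y, z) \<inter> ring (y, z, x) = {}"
    using assms(1-4) by (auto simp: ring_def)
  then have disj: "?A \<inter> (?B \<union> ?C) = {}" "?B \<inter> ?C = {}" by (auto split: if_splits)
  have "restrict_to (turn U) S = restrict_to (turn U) ?A \<circ> (restrict_to (turn U) ?B \<circ> restrict_to (turn U) ?C)"
    unfolding assms(5)
    by (subst restrict_to_Un[OF _ disj(1)], (auto simp: turn_U_mem_ring simp del: turn.simps split: if_splits)[1],
        subst restrict_to_Un[OF _ disj(2)], (auto simp: turn_U_mem_ring simp del: turn.simps split: if_splits)[1], rule refl)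
  moreover note sign_ring_if[of "(z, x, y)" P] sign_ring_if[of "(x, y, z)" Q] sign_ring_if[of "(y, z, x)" W]
  ultimately show ?thesis
    using assms(1-3) by (simp add: sign_compose permutation_compose)
qed

text \<open>At each positive height the rotated points form orbits of the quarter turn about the U
  axis, one for each coordinate that can be raised to that height. Negative heights are excluded
  because layers are counted from U in the upper half only.\<close>

lemma rots_level:
  assumes "x > 0" "y > 0" "z > 0"
    and "\<And>t. t < 0 \<Longrightarrow> \<not> M t"
  shows "{p \<in> rots (x, y, z). M (fst (snd p))} =
    (if M x then ring (z, x, y) else {}) \<union> ((if M y then ring (x, y, z) else {}) \<union>
      (if M z then ring (y, z, x) else {}))"
proof -
  have neg: "\<not> M (- x)" "\<not> M (- y)" "\<not> M (- z)" using assms by auto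
  show ?thesis
  proof (intro equalityI subsetI)
    fix p assume p: "p \<in> {p \<in> rots (x, y, z). M (fst (snd p))}"
    then have "p \<in> rots (x, y, z)" by blast
    then show "p \<in> (if M x then ring (z, x, y) else {}) \<union> ((if M y then ring (x, y, z) else {}) \<union>
      (if M z then ring (y, z, x) else {}))"
      unfolding rots.simps insert_iff empty_iff using p neg by (elim disjE; simp add: ring_def)
  next
    fix p assume "p \<in> (if M x then ring (z, x, y) else {}) \<union> ((if M y then ring (x, y, z) else {}) \<union>
      (if M z then ring (y, z, x) else {}))"
    then consider "M x" "p \<in> ring (z, x, y)" | "M y" "p \<in> ring (x, y, z)" | "M z" "p \<in> ring (y, z, x)"
      by (auto split: if_splits)
    then show "p \<in> {p \<in> rots (x, y, z). M (fst (snd p))}"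
      by cases (simp add: ring_def, elim disjE; simp)+
  qed
qed

section \<open>Turning several layers at once and its signs\<close>

context even_cube
begin

definition layers_turn :: "int set \<Rightarrow> point \<Rightarrow> point" where
  "layers_turn V = restrict_to (turn U) {f \<in> facelets n. fst (snd (cubie n f)) \<in> V}"

lemma dot_U: "dot p (normal U) = fst (snd p)"
  by (cases p) simp

lemma layers_turn_reachable:
  assumes "V \<subseteq> layers"
  shows "layers_turn V \<in> reachable n"
proof -
  have "finite V" using assms finite_layers finite_subset by blast
  then show ?thesis using assms
  proof (induction V)
    case empty
    have "layers_turn {} = id" by (simp add: layers_turn_def)
    then show ?case using reachable.solved by metis
  next
    case (insert c V)
    have "layers_turn (insert c V) f = (layer_turn n U c \<circ> layers_turn V) f" for f
    proof -
      have "fst (snd (cubie n (turn U f))) = fst (snd (cubie n f))"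
        using dot_turn_normal[of U "cubie n f"] by (simp only: dot_U cubie_turn')
      then show ?thesis using insert.hyps(2)
        unfolding layers_turn_def layer_turn_def restrict_to_def comp_def dot_U
        by (simp add: turn_mem_facelets del: turn.simps, metis)
    qed
    then have "layers_turn (insert c V) = layer_turn n U c \<circ> layers_turn V" by blast
    then show ?case using insert by (metis insert_subset layer_turn_comp_reachable)
  qed
qed

end

context keyed_orbit
begin

text \<open>The sign of the permutation that \<open>layers_turn V\<close> induces on the keys.
  Heights pass through \<open>shrink\<close> because the key of a center on U is the facelet itself,
  at height \<open>n\<close> instead of \<open>n - 1\<close>.\<close>

definition key_turn_sign :: "int set \<Rightarrow> int" where
  "key_turn_sign V = sign (restrict_to (turn U) {p \<in> rots k0. shrink n (fst (snd p)) \<in> V})"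

text \<open>With \<open>m\<close> the permutation induced by the layer turn, \<tau> composed with
  the inverse of \<open>m\<close> is even and so can be applied afterwards. The layer turn is kept
  apart from \<open>h\<close> because it is shared by all orbits, while \<open>h\<close> belongs to
  this orbit alone.\<close>

lemma block_realization:
  assumes "V \<subseteq> layers" "\<tau> permutes rots k0" "sign \<tau> = key_turn_sign V"
  shows "\<exists>h\<in>reachable n. (\<forall>f. f \<notin> block \<longrightarrow> h f = f) \<and> (\<forall>f\<in>block. h f \<in> block) \<and>
    (\<forall>f\<in>block. layers_turn V f \<in> block \<and> key (h (layers_turn V f)) = \<tau> (key f))"
proof -
  let ?S = "{p \<in> rots k0. shrink n (fst (snd p)) \<in> V}"
  let ?m = "restrict_to (turn U) ?S"
  have level: "fst (snd (turn U p)) = fst (snd p)" for p by (cases p) simp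
  have m: "?m permutes rots k0"
  proof (rule bij_imp_permutes)
    have "inj_on ?m (rots k0)"
      by (rule inj_on_subset[OF inj_restrict_to[OF inj_turn]]) (simp_all add: level turn_mem_rots_iff del: turn.simps)
    moreover have "?m ` rots k0 \<subseteq> rots k0"
      by (auto simp: restrict_to_def turn_mem_rots_iff simp del: turn.simps)
    ultimately show "bij_betw ?m (rots k0) (rots k0)"
      using finite_rots by (simp add: bij_betw_def endo_inj_surj)
  qed (simp add: restrict_to_def)
  have perm: "permutation \<tau>" "permutation (inv ?m)" "permutation ?m"
    using assms(2) m permutes_inv[OF m] finite_rots permutes_imp_permutation by blast+
  have "sign (\<tau> \<circ> inv ?m) = 1"
    using perm assms(3) by (simp add: sign_compose sign_inverse key_turn_sign_def)
  moreover have "\<tau> \<circ> inv ?m permutes rots k0"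
    using assms(2) permutes_inv[OF m] by (rule permutes_compose[rotated])
  ultimately have "\<tau> \<circ> inv ?m \<in> lifts" using even_permutation_lifts by blast
  then obtain h where h: "h \<in> reachable n" "\<forall>f. f \<notin> block \<longrightarrow> h f = f"
    "\<forall>f\<in>block. key (h f) = (\<tau> \<circ> inv ?m) (key f)" unfolding lifts_def by blast
  have "\<forall>f\<in>block. h f \<in> block"
    using lifts_maps_block[OF _ h(1,3)] assms(2) permutes_inv[OF m] permutes_compose by blast
  moreover have "layers_turn V f \<in> block \<and> key (h (layers_turn V f)) = \<tau> (key f)" if f: "f \<in> block" for f
  proof -
    have lev: "fst (snd (cubie n f)) = shrink n (fst (snd (key f)))"
      using cubie_key[of f] by (cases "key f") (metis cubie.simps fst_conv snd_conv)
    have blk: "layers_turn V f \<in> block"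
      using f by (simp add: layers_turn_def restrict_to_def turn_mem_block_iff del: turn.simps)
    moreover have "key (layers_turn V f) = ?m (key f)"
      using f by (simp add: layers_turn_def restrict_to_def lev key_turn block_def del: turn.simps)
    ultimately have "key (h (layers_turn V f)) = \<tau> (inv ?m (?m (key f)))" using h(3) by simp
    then show ?thesis using blk permutes_inverses(2)[OF m] by simp
  qed
  ultimately show ?thesis using h(1,2) by blast
qed

lemma key_turn_sign_generic:
  assumes "k0 = (x, y, z)" "x > 0" "y > 0" "z > 0" "\<not> (x = y \<and> y = z)" "V \<subseteq> layers"
  shows "key_turn_sign V =
    parity (shrink n x \<in> V) * parity (shrink n y \<in> V) * parity (shrink n z \<in> V)"
proof -
  have "shrink n t \<notin> V" if "t < 0" for t
    using that assms(6) n_ge_2 by (auto simp: shrink_def layers_def)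
  from sign_three_rings[OF assms(2-5) rots_level[OF assms(2-4), where M = "\<lambda>t. shrink n t \<in> V", OF this]]
  show ?thesis unfolding key_turn_sign_def unfolding assms(1) .
qed

text \<open>For a point with three equal coordinates the three rings are one and the same, so a
  single factor remains.\<close>

lemma key_turn_sign_corner:
  assumes "k0 = (x, x, x)" "x > 0" "V \<subseteq> layers"
  shows "key_turn_sign V = parity (shrink n x \<in> V)"
proof -
  have "shrink n t \<notin> V" if "t < 0" for t
    using that assms(3) n_ge_2 by (auto simp: shrink_def layers_def)
  from rots_level[OF assms(2,2,2), where M = "\<lambda>t. shrink n t \<in> V", OF this]
  have "{p \<in> rots k0. shrink n (fst (snd p)) \<in> V} = (if shrink n x \<in> V then ring (x, x, x) else {})"
    by (auto simp add: assms(1) simp del: rots.simps)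
  then show ?thesis using sign_ring_if(1)[of "(x, x, x)"] assms(2) by (simp add: key_turn_sign_def)
qed

end

section \<open>Orbits and labels\<close>

text \<open>A facelet can be rotated in exactly one way to \<open>(u, n, v)\<close> on the face U with \<open>u, v > 0\<close>;
  its label \<open>(u, v)\<close> is therefore a complete invariant under rotations.\<close>

fun label :: "nat \<Rightarrow> point \<Rightarrow> int \<times> int" where
  "label n (x, y, z) =
    (let (u, v) = (if \<bar>y\<bar> = int n then (\<bar>x\<bar>, \<bar>z\<bar>) else if \<bar>x\<bar> = int n then (\<bar>z\<bar>, \<bar>y\<bar>) else (\<bar>y\<bar>, \<bar>x\<bar>))
     in if (x > 0) = ((y > 0) = (z > 0)) then (u, v) else (v, u))"

context even_cube
begin

lemma facelet_nonzero: "(x, y, z) \<in> facelets n \<Longrightarrow> x \<noteq> 0 \<and> y \<noteq> 0 \<and> z \<noteq> 0"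
  using n_ge_2 by (auto simp: mem_facelets_iff)

text \<open>The test in \<open>label\<close> asks for the sign of the product of the coordinates. A
  quarter turn reverses this sign and also the order in which the two coordinates are read off, and
  the two reversals cancel.\<close>

lemma label_turn:
  assumes "f \<in> facelets n"
  shows "label n (turn X f) = label n f"
proof -
  obtain x y z where f: "f = (x, y, z)" by (cases f)
  have nz: "x \<noteq> 0" "y \<noteq> 0" "z \<noteq> 0" using assms facelet_nonzero f by auto
  have minus: "0 < - t \<longleftrightarrow> \<not> 0 < t" if "t \<noteq> 0" for t :: int using that by auto
  from assms consider "\<bar>x\<bar> = int n" "\<bar>y\<bar> \<noteq> int n" "\<bar>z\<bar> \<noteq> int n"
    | "\<bar>x\<bar> \<noteq> int n" "\<bar>y\<bar> = int n" "\<bar>z\<bar> \<noteq> int n" | "\<bar>x\<bar> \<noteq> int n" "\<bar>y\<bar> \<noteq> int n" "\<bar>z\<bar> = int n"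
    unfolding f mem_facelets_iff by linarith
  then show ?thesis
    by cases (cases X; simp add: f minus[OF nz(1)] minus[OF nz(2)] minus[OF nz(3)] del: neg_0_less_iff_less; argo?)+
qed

lemma label_reachable:
  assumes "g \<in> reachable n" "f \<in> facelets n"
  shows "label n (g f) = label n f"
  using assms(1)
proof (induction rule: reachable_induct)
  case (layer_turn g X c)
  then show ?case
    using assms(2) by (simp add: layer_turn_def label_turn reachable_mem_facelets del: label.simps)
qed simp

section \<open>The orbits of the cube as rotation orbits\<close>

definition lay :: "nat \<Rightarrow> int" where
  "lay i = int n + 1 - 2 * int i"

lemma lay_mem_layers: "1 \<le> i \<Longrightarrow> 2 * i \<le> n \<Longrightarrow> lay i \<in> layers"
  using layer_mem_layers by (simp add: lay_def)

lemma lay_1: "lay (Suc 0) = outer"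
  by (simp add: lay_def)

lemma lay_eq_iff: "lay i = lay j \<longleftrightarrow> i = j"
  by (simp add: lay_def)

lemma orbit_index:
  assumes "i \<in> orbit_indices n"
  shows "2 \<le> i" "2 * i \<le> n" "lay i \<in> layers" "0 < lay i" "lay i < outer"
    "coord n i = - lay i" "coord n (n + 1 - i) = lay i"
proof -
  show *: "2 \<le> i" "2 * i \<le> n" using assms by (auto simp: orbit_indices_def)
  show "lay i \<in> layers" using * by (intro lay_mem_layers) auto
  show "0 < lay i" "lay i < outer" "coord n i = - lay i" "coord n (n + 1 - i) = lay i"
    using * by (auto simp: lay_def coord_def)
qed

lemma corners_eq: "corners n = rots (outer, outer, outer)"
  by (auto simp: corners_def coord_def)

lemma coupled_edges_eq:
  assumes "i \<in> orbit_indices n"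
  shows "coupled_edges n i = rots (lay i, outer, outer)"
proof -
  have "coord n 1 = - outer" "coord n n = outer" by (simp_all add: coord_def)
  note this[unfolded One_nat_def] orbit_index(6,7)[OF assms]
  then show ?thesis unfolding coupled_edges_def Let_def by auto
qed

text \<open>The base point is the position \<open>(n + 1 - i, n + 1 - j)\<close> on U, the one of
  the four whose two coordinates within the face are both positive.\<close>

lemma center_edges_eq:
  assumes "i \<in> orbit_indices n" "j \<in> orbit_indices n"
  shows "center_edges n i j = rots (lay j, int n, lay i)"
proof (intro equalityI subsetI)
  note c = orbit_index(6,7)[OF assms(1)] orbit_index(6,7)[OF assms(2)]
  {
    fix p assume "p \<in> center_edges n i j"
    then obtain X r c where p: "p = facelet n X r c"
      and rc: "(r, c) \<in> {(i, j), (j, n + 1 - i), (n + 1 - i, n + 1 - j), (n + 1 - j, i)}"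
      unfolding center_edges_def by blast
    show "p \<in> rots (lay j, int n, lay i)"
      using rc unfolding insert_iff empty_iff prod.inject p by (elim disjE conjE FalseE; cases X; simp add: c del: One_nat_def)
  }
  have mem: "facelet n X i j \<in> center_edges n i j" "facelet n X j (n + 1 - i) \<in> center_edges n i j"
    "facelet n X (n + 1 - i) (n + 1 - j) \<in> center_edges n i j" "facelet n X (n + 1 - j) i \<in> center_edges n i j" for X
    unfolding center_edges_def by blast+
  fix p assume "p \<in> rots (lay j, int n, lay i)"
  then show "p \<in> center_edges n i j"
    using mem[of U] mem[of D] mem[of F] mem[of B] mem[of R] mem[of L]
    unfolding facelet.simps c rots.simps insert_iff empty_iff minus_minus by (elim disjE FalseE) simp_all
qed

lemma center_corners_eq:
  assumes "i \<in> orbit_indices n"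
  shows "center_corners n i = rots (lay i, int n, lay i)"
proof -
  have "center_corners n i = center_edges n i i"
    unfolding center_corners_def center_edges_def by blast
  then show ?thesis using center_edges_eq[OF assms assms] by simp
qed

lemma keyed_orbit_cubie:
  assumes "a \<in> layers" "b \<in> layers"
  shows "keyed_orbit n (cubie n) (a, outer, b) a b"
  using assms n_ge_2 by unfold_locales (simp_all add: cubie_turn' cubie_idem)

text \<open>With both coordinates below \<open>outer\<close>, the cubie has only one sticker, so the
  facelet itself can serve as key.\<close>

lemma keyed_orbit_center:
  assumes "a \<in> layers" "b \<in> layers" "a < outer" "b < outer"
  shows "keyed_orbit n id (a, int n, b) a b"
proof unfold_locales
  fix f assume "f \<in> facelets n"
  then show "id f = (a, int n, b) \<longleftrightarrow> cubie n f = (a, outer, b)"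
    using assms by (cases f) (auto simp: mem_facelets_iff shrink_def layers_def split: if_splits)
qed (use assms in simp_all)

text \<open>The maps preserve pairwise disjoint sets and are the identity elsewhere, so in their
  composite each one acts as if it were alone.\<close>

lemma finite_composition:
  assumes "finite I"
    and "\<And>i. i \<in> I \<Longrightarrow> H i \<in> reachable n" "\<And>i f. i \<in> I \<Longrightarrow> f \<notin> S i \<Longrightarrow> H i f = f"
    and "\<And>i f. i \<in> I \<Longrightarrow> f \<in> S i \<Longrightarrow> H i f \<in> S i"
    and "\<And>i j. i \<in> I \<Longrightarrow> j \<in> I \<Longrightarrow> i \<noteq> j \<Longrightarrow> S i \<inter> S j = {}"
  shows "\<exists>h\<in>reachable n. (\<forall>i\<in>I. \<forall>f\<in>S i. h f = H i f) \<and> (\<forall>f. f \<notin> (\<Union>i\<in>I. S i) \<longrightarrow> h f = f)"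
  using assms
proof (induction I)
  case empty
  then show ?case using reachable.solved by (intro bexI[of _ id]) simp_all
next
  case (insert i I)
  have "\<exists>h\<in>reachable n. (\<forall>i\<in>I. \<forall>f\<in>S i. h f = H i f) \<and> (\<forall>f. f \<notin> (\<Union>i\<in>I. S i) \<longrightarrow> h f = f)"
    by (rule insert.IH) (simp_all add: insert.prems)
  then obtain h where h: "h \<in> reachable n" "\<forall>j\<in>I. \<forall>f\<in>S j. h f = H j f"
    "\<forall>f. f \<notin> (\<Union>i\<in>I. S i) \<longrightarrow> h f = f" by blast
  have disj: "S i \<inter> S j = {}" if "j \<in> I" for j
    using insert.prems(4)[of i j] insert.hyps(2) that by blast
  have "H i \<circ> h \<in> reachable n" using insert.prems(1) h(1) by (intro reachable_comp) simp_all
  moreover have "(H i \<circ> h) f = H j f" if "j \<in> insert i I" "f \<in> S j" for j f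
  proof (cases "j = i")
    case True
    then have "f \<notin> (\<Union>i\<in>I. S i)" using that disj by blast
    then show ?thesis using True h(3) by simp
  next
    case False
    then have "j \<in> I" using that by simp
    then have "h f = H j f" "H j f \<notin> S i" using h(2) that insert.prems(3)[of j f] disj[of j] by auto
    then show ?thesis using insert.prems(2)[of i] by simp
  qed
  moreover have "(H i \<circ> h) f = f" if "f \<notin> (\<Union>i\<in>insert i I. S i)" for f
    using that h(3) insert.prems(2)[of i f] by simp
  ultimately show ?case by blast
qed

end

section \<open>Edge stickers\<close>

lemma turn_add: "turn X (p + q) = turn X p + turn X q"
  by (cases X; cases p; cases q) simp_all

lemma turned_face_opposite: "turned_face Z (turned_face (opposite Z) X) = X"
  by (rule injD[OF inj_normal]) (simp add: normal_turned_face)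

lemma on_face_turn: "on_face n (turn Z p) (turned_face Z X) \<longleftrightarrow> on_face n p X"
  by (simp add: on_face_def normal_turned_face dot_turn)

lemma left_handed_turn: "left_handed n (turn Z p) (turned_face Z X) \<longleftrightarrow> left_handed n p X"
proof -
  have iff: "turned_face Z Y \<noteq> turned_face Z X \<and> on_face n (turn Z p) (turned_face Z Y) \<and>
      dot (turn Z p) (turn (turned_face Z X) (normal (turned_face Z Y))) < 0 \<longleftrightarrow>
      Y \<noteq> X \<and> on_face n p Y \<and> dot p (turn X (normal Y)) < 0" for Y
  proof -
    have "turned_face Z Y = turned_face Z X \<longleftrightarrow> Y = X"
      by (metis inj_normal injD normal_turned_face turn_eq_iff)
    then show ?thesis
      by (simp only: on_face_turn normal_turned_face turn_turned_face dot_turn)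
  qed
  show ?thesis unfolding left_handed_def
  proof
    assume "\<exists>Y. Y \<noteq> turned_face Z X \<and> on_face n (turn Z p) Y \<and> dot (turn Z p) (turn (turned_face Z X) (normal Y)) < 0"
    then show "\<exists>Y. Y \<noteq> X \<and> on_face n p Y \<and> dot p (turn X (normal Y)) < 0"
      using iff turned_face_opposite by metis
  next
    assume "\<exists>Y. Y \<noteq> X \<and> on_face n p Y \<and> dot p (turn X (normal Y)) < 0"
    then show "\<exists>Y. Y \<noteq> turned_face Z X \<and> on_face n (turn Z p) Y \<and> dot (turn Z p) (turn (turned_face Z X) (normal Y)) < 0"
      using iff by metis
  qed
qed

context even_cube
begin

text \<open>Reduces rotation-invariant statements about the facelets of an orbit to the cubie
  \<open>k\<close>, where they become finite computations.\<close>

lemma cubie_rots_induct [consumes 2, case_names base turn]: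
  assumes "f \<in> facelets n" "cubie n f \<in> rots k"
    and base: "\<And>f. f \<in> facelets n \<Longrightarrow> cubie n f = k \<Longrightarrow> P f"
    and step: "\<And>f X. f \<in> facelets n \<Longrightarrow> cubie n f \<in> rots k \<Longrightarrow> P f \<Longrightarrow> P (turn X f)"
  shows "P f"
proof -
  let ?S = "{p \<in> rots k. \<forall>f. f \<in> facelets n \<longrightarrow> cubie n f = p \<longrightarrow> P f}"
  have S: "turn X p \<in> ?S" if p: "p \<in> ?S" for X p
  proof -
    have "P f" if "f \<in> facelets n" "cubie n f = turn X p" for f
    proof -
      let ?f = "turn (opposite X) f"
      have "?f \<in> facelets n" "cubie n ?f = p" using that by (simp_all add: turn_mem_facelets cubie_turn')
      then have "P (turn X ?f)" using p step by blast
      then show ?thesis by simp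
    qed
    then show ?thesis using p turn_mem_rots by blast
  qed
  have "rots k \<subseteq> ?S"
    by (rule rots_subset) (use base self_mem_rots S in blast)+
  then show ?thesis using assms(1,2) by blast
qed

lemma base_edge_facelets:
  assumes "a \<in> layers" "a < outer" "f \<in> facelets n" "cubie n f = (a, outer, outer)"
  shows "f = (a, int n, outer) \<or> f = (a, outer, int n)"
  using assms by (cases f) (auto simp: mem_facelets_iff shrink_def layers_def split: if_splits)

text \<open>At the base cubie the two stickers have the labels \<open>(a, outer)\<close> and
  \<open>(outer, a)\<close>, which differ because \<open>a < outer\<close>; rotations preserve
  labels.\<close>

lemma edge_facelet_unique:
  assumes "a \<in> layers" "a < outer" "f \<in> facelets n" "cubie n f \<in> rots (a, outer, outer)"
    and "f' \<in> facelets n" "cubie n f' = cubie n f" "label n f' = label n f"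
  shows "f' = f"
proof -
  have "\<forall>f'. f' \<in> facelets n \<and> cubie n f' = cubie n f \<and> label n f' = label n f \<longrightarrow> f' = f"
    using assms(3,4)
  proof (induction rule: cubie_rots_induct)
    case (base f)
    have "f' = f" if "f' \<in> facelets n" "cubie n f' = cubie n f" "label n f' = label n f" for f'
      using that base_edge_facelets[OF assms(1,2) base] base_edge_facelets[OF assms(1,2) that(1)]
        base(2) assms(1,2) by (auto simp: layers_def)
    then show ?case by blast
  next
    case (turn f X)
    have "f' = turn X f" if "f' \<in> facelets n" "cubie n f' = cubie n (turn X f)" "label n f' = label n (turn X f)" for f'
    proof -
      have "turn (opposite X) f' = f"
        using turn that by (auto simp: turn_mem_facelets cubie_turn' label_turn simp del: label.simps)
      then show ?thesis by auto
    qed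
    then show ?case by blast
  qed
  then show ?thesis using assms(5-7) by blast
qed

text \<open>Links handedness to the label: both are invariant under rotations of the whole cube, so
  they are compared at the base cubie only, whose U sticker is left-handed and whose F sticker is
  not.\<close>

lemma edge_stickers:
  assumes "a \<in> layers" "a < outer" "p \<in> rots (a, outer, outer)"
  shows "\<forall>X. on_face n p X \<longrightarrow> p + normal X \<in> facelets n \<and> cubie n (p + normal X) = p \<and>
      label n (p + normal X) = (if left_handed n p X then (a, outer) else (outer, a))"
    and "\<exists>X. on_face n p X \<and> (left_handed n p X \<longleftrightarrow> c)"
proof -
  let ?Q = "\<lambda>p. (\<forall>X. on_face n p X \<longrightarrow> p + normal X \<in> facelets n \<and> cubie n (p + normal X) = p \<and>
      label n (p + normal X) = (if left_handed n p X then (a, outer) else (outer, a))) \<and>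
    (\<forall>c. \<exists>X. on_face n p X \<and> (left_handed n p X \<longleftrightarrow> c))"
  have turn_Q: "?Q (turn Z p)" if Q: "?Q p" for Z p
  proof (intro conjI allI impI)
    fix X assume X: "on_face n (turn Z p) X"
    define Y where "Y = turned_face (opposite Z) X"
    have XY: "X = turned_face Z Y" by (simp add: Y_def turned_face_opposite)
    have "on_face n p Y" using X by (simp add: XY on_face_turn)
    then have Q': "p + normal Y \<in> facelets n" "cubie n (p + normal Y) = p"
      "label n (p + normal Y) = (if left_handed n p Y then (a, outer) else (outer, a))" using Q by blast+
    have eq: "turn Z p + normal X = turn Z (p + normal Y)" by (simp add: XY normal_turned_face turn_add)
    show "turn Z p + normal X \<in> facelets n" "cubie n (turn Z p + normal X) = turn Z p"
      "label n (turn Z p + normal X) = (if left_handed n (turn Z p) X then (a, outer) else (outer, a))"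
      unfolding eq using Q' by (simp_all add: turn_mem_facelets cubie_turn' label_turn XY left_handed_turn del: label.simps)
  next
    fix c
    show "\<exists>X. on_face n (turn Z p) X \<and> left_handed n (turn Z p) X = c"
      using Q on_face_turn left_handed_turn by metis
  qed
  have pos: "0 < a" "odd a" "a < int n" "1 < int n" using assms(1) n_ge_2 by (auto simp: layers_def)
  have on: "on_face n (a, outer, outer) X \<longleftrightarrow> X = U \<or> X = F" for X
    using assms(2) pos by (cases X) (auto simp: on_face_def coord_def)
  have lh: "left_handed n (a, outer, outer) U" "\<not> left_handed n (a, outer, outer) F"
    using assms(2) pos by (auto simp: left_handed_def ex_face on)
  have base: "?Q (a, outer, outer)"
    using lh assms(2) pos even_n
    by (auto simp: on ex_face mem_facelets_iff shrink_def)
  have "rots (a, outer, outer) \<subseteq> {p. ?Q p}"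
    by (rule rots_subset) (use base turn_Q in blast)+
  then have "?Q p" using assms(3) by blast
  then show "\<forall>X. on_face n p X \<longrightarrow> p + normal X \<in> facelets n \<and> cubie n (p + normal X) = p \<and>
      label n (p + normal X) = (if left_handed n p X then (a, outer) else (outer, a))"
    "\<exists>X. on_face n p X \<and> (left_handed n p X \<longleftrightarrow> c)" by blast+
qed

lemma edge_face_sticker:
  fixes j :: 2
  assumes "a \<in> layers" "a < outer" "p \<in> rots (a, outer, outer)"
  defines "f \<equiv> p + normal (edge_face n p j)"
  shows "f \<in> facelets n" "cubie n f = p" "label n f = (if j = 0 then (a, outer) else (outer, a))"
proof -
  let ?Q = "\<lambda>X. on_face n p X \<and> (left_handed n p X \<longleftrightarrow> j = 0)"
  note st = edge_stickers(1)[OF assms(1-3), rule_format]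
  obtain X where X: "?Q X" using edge_stickers(2)[OF assms(1-3)] by blast
  have "Y = X" if "?Q Y" for Y
  proof -
    have "p + normal Y = p + normal X"
      by (rule edge_facelet_unique[OF assms(1,2)]) (use st[of X] st[of Y] X that assms(3) in simp_all)
    then show ?thesis by (simp add: inj_eq[OF inj_normal])
  qed
  then have "edge_face n p j = X" unfolding edge_face_def using X by (intro the_equality)
  then show "f \<in> facelets n" "cubie n f = p" "label n f = (if j = 0 then (a, outer) else (outer, a))"
    unfolding f_def using st[of X] X by simp_all
qed

text \<open>Position and label together determine the sticker, and moves preserve labels. Hence the
  destination of an edge cubie decides that of both stickers, always with orientation 0.\<close>

lemma reachable_edge_sticker:
  assumes "i \<in> orbit_indices n" "g \<in> reachable n" "p \<in> coupled_edges n i"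
    and "\<And>f. f \<in> facelets n \<Longrightarrow> cubie n f = p \<Longrightarrow> cubie n (g f) = q"
    and "q \<in> coupled_edges n i"
  shows "g (p + normal (edge_face n p j)) = q + normal (edge_face n q j)"
proof (rule edge_facelet_unique[of "lay i"])
  note i = orbit_index[OF assms(1)]
  show "lay i \<in> layers" "lay i < outer" using i by auto
  note p = edge_face_sticker[OF i(3,5) assms(3)[unfolded coupled_edges_eq[OF assms(1)]]]
  note q = edge_face_sticker[OF i(3,5) assms(5)[unfolded coupled_edges_eq[OF assms(1)]]]
  show "q + normal (edge_face n q j) \<in> facelets n" by (rule q)
  show "cubie n (q + normal (edge_face n q j)) \<in> rots (lay i, outer, outer)"
    using q(2) assms(5) coupled_edges_eq[OF assms(1)] by (simp del: rots.simps)
  show "g (p + normal (edge_face n p j)) \<in> facelets n" using p(1) assms(2) reachable_mem_facelets by blast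
  show "cubie n (g (p + normal (edge_face n p j))) = cubie n (q + normal (edge_face n q j))"
    using assms(4) p(1,2) q(2) by metis
  show "label n (g (p + normal (edge_face n p j))) = label n (q + normal (edge_face n q j))"
    using label_reachable[OF assms(2) p(1)] p(3) q(3) by metis
qed

end

section \<open>Corner twists\<close>

lemma three_cases: "t = 0 \<or> t = 1 \<or> t = (2::3)"
proof (induct t)
  case (of_int z)
  then have "z = 0 \<or> z = 1 \<or> z = 2" by auto
  then show ?case by auto
qed

text \<open>On the facelets of a corner cubie this is the rotation by 120 degrees about the diagonal of
  that cubie, clockwise as seen from outside.\<close>

fun spin :: "point \<Rightarrow> point" where
  "spin (x, y, z) =
    (let s = (\<lambda>t v. if t > 0 then \<bar>v\<bar> else - \<bar>v\<bar>)
     in if (x > 0) = ((y > 0) = (z > 0)) then (s x y, s y z, s z x) else (s x z, s y x, s z y))"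

definition spins :: "3 \<Rightarrow> point \<Rightarrow> point" where
  "spins t f = (if t = 0 then f else if t = 1 then spin f else spin (spin f))"

context even_cube
begin

definition corner_facelets :: "point set" where
  "corner_facelets = {f \<in> facelets n. cubie n f \<in> corners n}"

lemma turn_mem_corners: "turn X p \<in> corners n \<longleftrightarrow> p \<in> corners n"
  unfolding corners_eq by (rule turn_mem_rots_iff)

lemma finite_corners: "finite (corners n)"
  unfolding corners_eq by (rule finite_rots)

lemma turn_mem_corner_facelets: "turn X f \<in> corner_facelets \<longleftrightarrow> f \<in> corner_facelets"
  by (simp add: corner_facelets_def turn_mem_facelets cubie_turn' turn_mem_corners)

lemma spin_turn:
  assumes "f \<in> facelets n"
  shows "spin (turn X f) = turn X (spin f)"
proof -
  obtain x y z where f: "f = (x, y, z)" by (cases f)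
  have nz: "x \<noteq> 0" "y \<noteq> 0" "z \<noteq> 0" using assms facelet_nonzero f by auto
  have sgn: "t > 0 \<or> t < 0" if "t \<noteq> 0" for t :: int using that by auto
  show ?thesis
    unfolding f using sgn[OF nz(1)] sgn[OF nz(2)] sgn[OF nz(3)]
    by (elim disjE; cases X; simp)
qed

lemma corner_facelet_spin:
  assumes "f \<in> corner_facelets"
  shows "spin f \<in> facelets n" "cubie n (spin f) = cubie n f" "spin (spin (spin f)) = f" "spin f \<noteq> f"
    and "f' \<in> facelets n \<Longrightarrow> cubie n f' = cubie n f \<Longrightarrow> f' \<in> {f, spin f, spin (spin f)}"
proof -
  have f: "f \<in> facelets n" "cubie n f \<in> rots (outer, outer, outer)"
    using assms by (simp_all add: corner_facelets_def corners_eq del: rots.simps)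
  have cube: "f = (int n, outer, outer) \<or> f = (outer, int n, outer) \<or> f = (outer, outer, int n)"
    if "f \<in> facelets n" "cubie n f = (outer, outer, outer)" for f
    using that n_ge_2 by (cases f) (auto simp: mem_facelets_iff shrink_def split: if_splits)
  have "spin f \<in> facelets n \<and> spin (spin f) \<in> facelets n \<and> cubie n (spin f) = cubie n f \<and> spin (spin (spin f)) = f \<and> spin f \<noteq> f \<and>
    (\<forall>f'. f' \<in> facelets n \<longrightarrow> cubie n f' = cubie n f \<longrightarrow> f' \<in> {f, spin f, spin (spin f)})"
    using f
  proof (induction rule: cubie_rots_induct)
    case (base f)
    have "f' \<in> {f, spin f, spin (spin f)}" if "f' \<in> facelets n" "cubie n f' = cubie n f" for f'
      using cube[OF base] cube[OF that(1)] that(2) base(2) n_ge_2 by auto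
    moreover have "spin f \<in> facelets n" "spin (spin f) \<in> facelets n" "cubie n (spin f) = cubie n f" "spin (spin (spin f)) = f" "spin f \<noteq> f"
      using cube[OF base] n_ge_2 even_n by (auto simp: mem_facelets_iff shrink_def)
    ultimately show ?case by blast
  next
    case (turn f X)
    then have s: "spin (turn X f) = turn X (spin f)" "spin (turn X (spin f)) = turn X (spin (spin f))"
      by (auto intro: spin_turn)
    have "f' \<in> {turn X f, turn X (spin f), turn X (spin (spin f))}"
      if "f' \<in> facelets n" "cubie n f' = cubie n (turn X f)" for f'
    proof -
      have "turn (opposite X) f' \<in> {f, spin f, spin (spin f)}"
        using turn that by (simp add: turn_mem_facelets cubie_turn' del: spin.simps)
      then show ?thesis by (simp add: turn_eq_iff_opposite del: spin.simps)
    qed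
    moreover have "spin (turn X (spin (spin f))) = turn X f"
      using turn.IH spin_turn by metis
    ultimately show ?case using turn unfolding s
      by (simp add: turn_mem_facelets cubie_turn' turn_eq_iff del: spin.simps)
  qed
  then show "spin f \<in> facelets n" "cubie n (spin f) = cubie n f" "spin (spin (spin f)) = f" "spin f \<noteq> f"
    "f' \<in> facelets n \<Longrightarrow> cubie n f' = cubie n f \<Longrightarrow> f' \<in> {f, spin f, spin (spin f)}"
    by blast+
qed

lemma spin_mem_corner_facelets: "f \<in> corner_facelets \<Longrightarrow> spin f \<in> corner_facelets"
  using corner_facelet_spin(1,2) by (simp add: corner_facelets_def)

lemma spins_mem_corner_facelets: "f \<in> corner_facelets \<Longrightarrow> spins t f \<in> corner_facelets"
  by (simp add: spins_def spin_mem_corner_facelets)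

lemma cubie_spins: "f \<in> corner_facelets \<Longrightarrow> cubie n (spins t f) = cubie n f"
  by (simp add: spins_def spin_mem_corner_facelets corner_facelet_spin(2))

lemma spins_spins: "f \<in> corner_facelets \<Longrightarrow> spins s (spins t f) = spins (s + t) f"
  using three_cases[of s] three_cases[of t] by (auto simp: spins_def corner_facelet_spin(3) simp del: spin.simps)

lemma spins_inj:
  assumes "f \<in> corner_facelets" "spins s f = spins t f"
  shows "s = t"
proof -
  note f = assms(1) spin_mem_corner_facelets[OF assms(1)]
  have "spin f \<noteq> f" "spin (spin f) \<noteq> spin f" "spin (spin f) \<noteq> f"
    using corner_facelet_spin(4)[OF f(1)] corner_facelet_spin(4)[OF f(2)] corner_facelet_spin(3)[OF f(1)] by metis+
  then show ?thesis
    using assms(2) three_cases[of s] three_cases[of t] by (auto simp: spins_def simp del: spin.simps split: if_splits)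
qed

lemma same_corner_spins:
  assumes "f \<in> corner_facelets" "f' \<in> facelets n" "cubie n f' = cubie n f"
  shows "\<exists>t. f' = spins t f"
proof -
  have "f' = f \<or> f' = spin f \<or> f' = spin (spin f)" using corner_facelet_spin(5)[OF assms] by blast
  then have "f' = spins 0 f \<or> f' = spins 1 f \<or> f' = spins 2 f" by (simp add: spins_def del: spin.simps)
  then show ?thesis by blast
qed

lemma spins_turn: "f \<in> corner_facelets \<Longrightarrow> spins t (turn X f) = turn X (spins t f)"
  using spin_turn[of f X] spin_turn[of "spin f" X] corner_facelet_spin(1)
  by (simp add: spins_def corner_facelets_def del: spin.simps)

text \<open>Moves carry a corner rigidly and never reflect it, so they commute with its clockwise
  rotation. One sticker of a corner thus determines the other two.\<close>

lemma reachable_corner_facelet: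
  assumes "g \<in> reachable n" "f \<in> corner_facelets"
  shows "g f \<in> corner_facelets \<and> g (spins t f) = spins t (g f)"
  using assms(1)
proof (induction rule: reachable_induct)
  case (layer_turn g X c)
  then have gf: "g f \<in> corner_facelets" "g (spins t f) = spins t (g f)" by auto
  then have "cubie n (spins t (g f)) = cubie n (g f)" "spins t (g f) \<in> facelets n" "g f \<in> facelets n"
    using spins_mem_corner_facelets[of "g f" t] by (simp_all add: cubie_spins corner_facelets_def)
  then show ?case using gf
    by (simp add: layer_turn_def spins_turn turn_mem_corner_facelets)
qed (use assms(2) in auto)

section \<open>Twisting two corners in opposite directions\<close>

definition twist :: "(point \<Rightarrow> 3) \<Rightarrow> point \<Rightarrow> point" where
  "twist d f = (if f \<in> corner_facelets then spins (d (cubie n f)) f else f)"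

lemma twist_comp: "twist d \<circ> twist d' = twist (\<lambda>p. d p + d' p)"
  by (auto simp: fun_eq_iff twist_def spins_mem_corner_facelets cubie_spins spins_spins)

lemma twist_zero: "twist (\<lambda>p. 0) = id"
  by (simp add: fun_eq_iff twist_def spins_def)

lemma twist_cong: "(\<And>p. p \<in> corners n \<Longrightarrow> d p = d' p) \<Longrightarrow> twist d = twist d'"
  by (auto simp: fun_eq_iff twist_def corner_facelets_def)

lemma conj_turn_twist: "turn X \<circ> twist d \<circ> turn (opposite X) = twist (\<lambda>p. d (turn (opposite X) p))"
proof
  fix f
  show "(turn X \<circ> twist d \<circ> turn (opposite X)) f = twist (\<lambda>p. d (turn (opposite X) p)) f"
    using spins_turn[of "turn (opposite X) f" _ X]
    by (simp add: twist_def turn_mem_corner_facelets cubie_turn')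
qed

definition pair_twist :: "point \<Rightarrow> point \<Rightarrow> point \<Rightarrow> 3" where
  "pair_twist p q c = (if c = p then 1 else 0) - (if c = q then 1 else 0)"

abbreviation twistable :: "point \<Rightarrow> point \<Rightarrow> bool" where
  "twistable p q \<equiv> twist (pair_twist p q) \<in> reachable n"

lemma twistable_refl: "twistable p p"
proof -
  have "pair_twist p p = (\<lambda>c. 0)" by (simp add: pair_twist_def fun_eq_iff)
  then show ?thesis using reachable.solved twist_zero by metis
qed

lemma twistable_trans: "twistable p q \<Longrightarrow> twistable q r \<Longrightarrow> twistable p r"
  using reachable_comp[of "twist (pair_twist p q)" "twist (pair_twist q r)"]
  by (simp add: twist_comp pair_twist_def[abs_def])

text \<open>Modulo 3, doubling is negation: performing the twist twice reverses it.\<close>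

lemma twistable_sym: "twistable p q \<Longrightarrow> twistable q p"
proof -
  assume "twistable p q"
  then have "twist (\<lambda>c. pair_twist p q c + pair_twist p q c) \<in> reachable n"
    using reachable_comp twist_comp by metis
  moreover have "(\<lambda>c. pair_twist p q c + pair_twist p q c) = pair_twist q p"
    by (auto simp: pair_twist_def fun_eq_iff)
  ultimately show ?thesis by simp
qed

lemma twistable_turn: "twistable p q \<Longrightarrow> twistable (turn X p) (turn X q)"
proof -
  assume "twistable p q"
  then have "twist (\<lambda>c. pair_twist p q (turn (opposite X) c)) \<in> reachable n"
    using conj_turn_reachable conj_turn_twist by metis
  moreover have "(\<lambda>c. pair_twist p q (turn (opposite X) c)) = pair_twist (turn X p) (turn X q)"
    by (simp add: pair_twist_def fun_eq_iff turn_eq_iff_opposite)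
  ultimately show ?thesis by simp
qed

lemma shrink_pos_iff: "0 < shrink n t \<longleftrightarrow> 0 < t"
  using n_ge_2 by (auto simp: shrink_def)

text \<open>Three corner 3-cycles are composed so that all positions return while two corners do not
  return to their orientation. Away from the corners none of the three factors moves
  anything.\<close>

lemma base_twistable: "twistable (outer, outer, outer) (outer, outer, - outer)"
proof -
  define N where "N = outer"
  have N: "N > 0" "N \<noteq> - N" "- N \<noteq> N" "N \<noteq> 0" using n_ge_2 by (auto simp: N_def)
  let ?P = "{f \<in> facelets n. cubie n f = (N, N, N)}"
  obtain t where t: "t \<in> reachable n"
    and tP: "\<forall>f\<in>?P. t f = turn R f \<and> t (turn R f) = turn L (turn U f) \<and> t (turn L (turn U f)) = f"
    and t0: "\<forall>f. f \<notin> ?P \<and> f \<notin> turn R ` ?P \<and> f \<notin> (\<lambda>f. turn L (turn U f)) ` ?P \<longrightarrow> t f = f"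
    using three_cubie_commutator[OF outer_mem_layers outer_mem_layers] unfolding N_def by blast
  have LR: "turn L (turn R f) = f" "turn R (turn L f) = f" "turn U (turn D f) = f" "turn D (turn U f) = f" for f
    by (cases f; simp)+
  have t_eq: "t f = (if cubie n f = (N, N, N) then turn R f
      else if cubie n f = (N, N, - N) then turn L (turn U (turn L f))
      else if cubie n f = (- N, - N, N) then turn D (turn R f) else f)" if f: "f \<in> facelets n" for f
  proof -
    have 1: "t f = turn R f" if "cubie n f = (N, N, N)" using tP f that by blast
    have 2: "t f = turn L (turn U (turn L f))" if "cubie n f = (N, N, - N)"
    proof -
      have "turn L f \<in> ?P" using f that by (simp add: turn_mem_facelets cubie_turn')
      then have "t (turn R (turn L f)) = turn L (turn U (turn L f))" using tP by blast
      then show ?thesis by (simp only: LR)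
    qed
    have 3: "t f = turn D (turn R f)" if "cubie n f = (- N, - N, N)"
    proof -
      have "turn D (turn R f) \<in> ?P" using f that by (simp add: turn_mem_facelets cubie_turn')
      then have "t (turn L (turn U (turn D (turn R f)))) = turn D (turn R f)" using tP by blast
      then show ?thesis by (simp only: LR)
    qed
    have "t f = f" if "cubie n f \<notin> {(N, N, N), (N, N, - N), (- N, - N, N)}"
    proof -
      have "f \<notin> ?P" "f \<notin> turn R ` ?P" "f \<notin> (\<lambda>f. turn L (turn U f)) ` ?P"
        using that by (auto simp: cubie_turn' simp del: turn.simps) (auto simp: cubie_turn')
      then show ?thesis using t0 by blast
    qed
    then show ?thesis using 1 2 3 by simp
  qed
  have t_out: "t f = f" if "f \<notin> facelets n" for f using reachable_outside[OF t that] .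
  \<comment> \<open>Let A, A', D, E be the corners \<open>(N, N, N)\<close>,
    \<open>(N, N, - N)\<close>, \<open>(- N, - N, - N)\<close>, \<open>(- N, - N, N)\<close>. Then
    \<open>t\<close> cycles A, A', E. The rotations U, R, U and U, L, U send
    \<open>(x, y, z)\<close> to \<open>(y, x, -z)\<close> and to \<open>(-y, -x, -z)\<close>, so
    \<open>t1\<close> cycles A', A, D and \<open>t2\<close> cycles D, E, A'. On positions
    \<open>t1 \<circ> (t \<circ> t2)\<close> is the identity; on stickers it spins A once and A'
    twice.\<close>
  define t1 where "t1 = turn U \<circ> (turn R \<circ> (turn U \<circ> t \<circ> turn D) \<circ> turn L) \<circ> turn D"
  define t2 where "t2 = turn U \<circ> (turn L \<circ> (turn U \<circ> t \<circ> turn D) \<circ> turn R) \<circ> turn D"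
  have "t1 \<in> reachable n" "t2 \<in> reachable n"
    using conj_turn_reachable[OF conj_turn_reachable[OF conj_turn_reachable[OF t, of U], of R], of U]
      conj_turn_reachable[OF conj_turn_reachable[OF conj_turn_reachable[OF t, of U], of L], of U]
    by (simp_all only: t1_def t2_def opposite.simps)
  then have "t1 \<circ> (t \<circ> t2) \<in> reachable n" using t by (intro reachable_comp)
  moreover have "(t1 \<circ> (t \<circ> t2)) f = twist (pair_twist (N, N, N) (N, N, - N)) f" for f
  proof (cases "f \<in> facelets n")
    case False
    then show ?thesis
      by (simp add: t1_def t2_def t_out turn_mem_facelets LR twist_def corner_facelets_def del: turn.simps)
  next
    case True
    show ?thesis
    proof (cases "cubie n f \<in> corners n")
      case False
      have out: "(u, v, w) \<in> corners n" if "u \<in> {N, -N}" "v \<in> {N, -N}" "w \<in> {N, -N}" for u v w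
        using that by (auto simp: corners_def coord_def N_def)
      have unmoved: "t h = h" if "h \<in> facelets n" "cubie n h \<notin> corners n" for h
        using t_eq[OF that(1)] that(2) out by auto
      show ?thesis using True False
        by (simp add: t1_def t2_def unmoved turn_mem_facelets cubie_turn' turn_mem_corners LR twist_def
            corner_facelets_def del: turn.simps)
    next
      case corner: True
      obtain x y z where f: "f = (x, y, z)" by (cases f)
      have "cubie n f \<in> {N, -N} \<times> {N, -N} \<times> {N, -N}"
        using corner by (auto simp: corners_def coord_def N_def)
      then have cases: "cubie n f = (N, N, N) \<or> cubie n f = (N, N, -N) \<or> cubie n f = (N, -N, N) \<or> cubie n f = (N, -N, -N) \<or>
        cubie n f = (-N, N, N) \<or> cubie n f = (-N, N, -N) \<or> cubie n f = (-N, -N, N) \<or> cubie n f = (-N, -N, -N)"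
        by auto
      have tw: "twist (pair_twist (N, N, N) (N, N, - N)) f =
        (if cubie n f = (N, N, N) then spin f else if cubie n f = (N, N, - N) then spin (spin f) else f)"
        using True corner N by (simp add: twist_def corner_facelets_def pair_twist_def spins_def del: spin.simps)
      have c1: "spin f = (y, z, x)" if "cubie n f = (N, N, N)"
        using that N(1) shrink_pos_iff[of x] shrink_pos_iff[of y] shrink_pos_iff[of z] by (simp add: f)
      have c2: "spin (spin f) = (y, -z, -x)" if "cubie n f = (N, N, -N)"
        using that N(1) shrink_pos_iff[of x] shrink_pos_iff[of y] shrink_pos_iff[of z]
          facelet_nonzero[OF True[unfolded f]] by (auto simp: f)
      show ?thesis unfolding tw
        using cases
        by (elim disjE;
            simp add: t1_def t2_def t_eq True turn_mem_facelets cubie_turn' N c1 c2 del: cubie.simps spin.simps)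
          (simp_all add: f N)
    qed
  qed
  then have "t1 \<circ> (t \<circ> t2) = twist (pair_twist (N, N, N) (N, N, - N))" by (rule ext)
  ultimately show ?thesis unfolding N_def by (simp only:)
qed

end

section \<open>All corner twists of total zero\<close>

context even_cube
begin

lemma all_twistable:
  assumes "p \<in> corners n"
  shows "twistable p (outer, outer, outer)"
proof -
  let ?k = "(outer, outer, outer)" and ?k' = "(outer, outer, - outer)"
  have R: "twistable ?k (turn R ?k)" using base_twistable by simp
  have "twistable (turn U ?k') (turn U ?k)" using base_twistable twistable_turn twistable_sym by metis
  then have U: "twistable ?k (turn U ?k)" by simp
  have "rots ?k \<subseteq> {p. twistable ?k p}"
    by (rule rots_subset) (use R U twistable_refl twistable_trans twistable_turn in blast)+
  then show ?thesis using assms twistable_sym unfolding corners_eq by blast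
qed

lemma scaled_twist_reachable:
  assumes "p \<in> corners n"
  shows "twist (\<lambda>c. t * pair_twist p (outer, outer, outer) c) \<in> reachable n"
proof -
  let ?d = "pair_twist p (outer, outer, outer)"
  note tw = all_twistable[OF assms]
  have two: "twist (\<lambda>c. ?d c + ?d c) \<in> reachable n" using reachable_comp[OF tw tw] by (simp only: twist_comp)
  consider "t = 0" | "t = 1" | "t = 2" using three_cases[of t] by blast
  then show ?thesis
  proof cases
    case 1
    then show ?thesis using reachable.solved by (simp only: mult_zero_left twist_zero)
  next
    case 2
    then show ?thesis using tw by simp
  next
    case 3
    then show ?thesis using two by (simp only: mult_2)
  qed
qed

text \<open>Every corner is twisted as required against one fixed corner. What accumulates at the
  fixed corner is its own share minus the total, and the total is zero.\<close>

lemma twist_reachable: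
  assumes "(\<Sum>p\<in>corners n. d p) = 0"
  shows "twist d \<in> reachable n"
proof -
  let ?k = "(outer, outer, outer)"
  have "twist (\<lambda>c. \<Sum>p\<in>S. d p * pair_twist p ?k c) \<in> reachable n" if "finite S" "S \<subseteq> corners n" for S
    using that
  proof (induction S)
    case empty
    show ?case using reachable.solved by (simp only: sum.empty twist_zero)
  next
    case (insert p S)
    then have "twist (\<lambda>c. d p * pair_twist p ?k c) \<circ> twist (\<lambda>c. \<Sum>p\<in>S. d p * pair_twist p ?k c) \<in> reachable n"
      using scaled_twist_reachable by (intro reachable_comp) blast+
    then show ?case using insert.hyps by (simp only: twist_comp sum.insert not_False_eq_True)
  qed
  from this[OF finite_corners subset_refl]
  have "twist (\<lambda>c. \<Sum>p\<in>corners n. d p * pair_twist p ?k c) \<in> reachable n" .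
  moreover have "(\<Sum>p\<in>corners n. d p * pair_twist p ?k c) = d c" if "c \<in> corners n" for c
  proof -
    have "(\<Sum>p\<in>corners n. d p * pair_twist p ?k c) =
      (\<Sum>p\<in>corners n. (if p = c then d p else 0)) - (\<Sum>p\<in>corners n. d p * (if c = ?k then 1 else 0))"
      unfolding sum_subtractf[symmetric] by (rule sum.cong) (auto simp: pair_twist_def)
    also have "(\<Sum>p\<in>corners n. d p * (if c = ?k then 1 else 0)) = 0"
      using assms by (simp add: sum_distrib_right[symmetric])
    finally show ?thesis using that finite_corners by simp
  qed
  then have "twist (\<lambda>c. \<Sum>p\<in>corners n. d p * pair_twist p ?k c) = twist d" by (rule twist_cong)
  ultimately show ?thesis by (simp only:)
qed

end

text \<open>One sticker of each corner is singled out, and orientations are measured relative to it.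
  Any choice works, so the analysis of twists is independent of the white face.\<close>

locale corner_reference = even_cube +
  fixes ref :: "point \<Rightarrow> point"
  assumes ref_facelet: "p \<in> corners n \<Longrightarrow> ref p \<in> facelets n"
    and cubie_ref: "p \<in> corners n \<Longrightarrow> cubie n (ref p) = p"
begin

definition acts :: "(point \<Rightarrow> point) \<Rightarrow> (point \<Rightarrow> point) \<Rightarrow> (point \<Rightarrow> 3) \<Rightarrow> bool" where
  "acts g \<sigma> x \<longleftrightarrow> \<sigma> permutes corners n \<and> (\<forall>p\<in>corners n. g (ref p) = spins (x (\<sigma> p)) (ref (\<sigma> p)))"

lemma ref_corner: "p \<in> corners n \<Longrightarrow> ref p \<in> corner_facelets"
  by (simp add: corner_facelets_def ref_facelet cubie_ref)

lemma acts_id: "acts id id (\<lambda>p. 0)"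
  by (simp add: acts_def spins_def)

text \<open>Orientations are indexed by present positions, so those of the inner map are carried
  along by \<sigma>; such a reindexing does not change their sum, which makes the total twist
  additive.\<close>

lemma acts_comp:
  assumes "acts g \<sigma> x" "acts h \<tau> y" "g \<in> reachable n"
  shows "\<exists>z. acts (g \<circ> h) (\<sigma> \<circ> \<tau>) z \<and> (\<Sum>p\<in>corners n. z p) = (\<Sum>p\<in>corners n. x p) + (\<Sum>p\<in>corners n. y p)"
proof (intro exI conjI)
  let ?z = "\<lambda>q. x q + y (inv \<sigma> q)"
  have perm: "\<sigma> permutes corners n" "\<tau> permutes corners n" using assms by (auto simp: acts_def)
  have "(g \<circ> h) (ref p) = spins (?z ((\<sigma> \<circ> \<tau>) p)) (ref ((\<sigma> \<circ> \<tau>) p))" if p: "p \<in> corners n" for p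
  proof -
    have q: "\<tau> p \<in> corners n" "\<sigma> (\<tau> p) \<in> corners n" using p perm by (simp_all add: permutes_in_image)
    have "(g \<circ> h) (ref p) = g (spins (y (\<tau> p)) (ref (\<tau> p)))" using assms(2) p by (simp add: acts_def)
    also have "\<dots> = spins (y (\<tau> p)) (g (ref (\<tau> p)))"
      using reachable_corner_facelet[OF assms(3) ref_corner[OF q(1)]] by blast
    also have "g (ref (\<tau> p)) = spins (x (\<sigma> (\<tau> p))) (ref (\<sigma> (\<tau> p)))" using assms(1) q by (simp add: acts_def)
    finally show ?thesis
      using spins_spins[OF ref_corner[OF q(2)]] permutes_inverses(2)[OF perm(1)] by (simp add: add.commute)
  qed
  then show "acts (g \<circ> h) (\<sigma> \<circ> \<tau>) ?z"
    unfolding acts_def using permutes_compose[OF perm(2,1)] by blast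
  have "(\<Sum>p\<in>corners n. y (inv \<sigma> p)) = (\<Sum>p\<in>corners n. y p)"
    using sum.permute[OF permutes_inv[OF perm(1)], of y] by (simp add: comp_def)
  then show "(\<Sum>p\<in>corners n. ?z p) = (\<Sum>p\<in>corners n. x p) + (\<Sum>p\<in>corners n. y p)"
    by (simp add: sum.distrib)
qed

lemma acts_unique:
  assumes "acts g \<sigma> x" "acts g \<tau> y"
  shows "p \<in> corners n \<Longrightarrow> \<sigma> p = \<tau> p" "q \<in> corners n \<Longrightarrow> x q = y q"
proof -
  have perm: "\<sigma> permutes corners n" "\<tau> permutes corners n" using assms by (auto simp: acts_def)
  show eq: "\<sigma> p = \<tau> p" if p: "p \<in> corners n" for p
  proof -
    have q: "\<sigma> p \<in> corners n" "\<tau> p \<in> corners n" using p perm by (simp_all add: permutes_in_image)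
    have "g (ref p) = spins (x (\<sigma> p)) (ref (\<sigma> p))" "g (ref p) = spins (y (\<tau> p)) (ref (\<tau> p))"
      using assms p by (auto simp: acts_def)
    then show ?thesis using q cubie_spins ref_corner cubie_ref by metis
  qed
  show "x q = y q" if q: "q \<in> corners n"
  proof -
    obtain p where p: "p \<in> corners n" "q = \<sigma> p" using q perm(1) by (metis permutes_image imageE)
    have "g (ref p) = spins (x (\<sigma> p)) (ref (\<sigma> p))" "g (ref p) = spins (y (\<tau> p)) (ref (\<tau> p))"
      using assms p(1) by (auto simp: acts_def)
    then have "spins (x q) (ref q) = spins (y q) (ref q)" using eq[OF p(1)] p(2) by simp
    then show ?thesis using spins_inj ref_corner[OF q] by blast
  qed
qed

text \<open>Existence of some orientation vector is enough: its total is found later from the order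
  of the turn, so the twists of the individual moves need not be computed for a particular
  \<open>ref\<close>.\<close>

lemma acts_layer_turn:
  assumes "c \<in> layers"
  shows "\<exists>\<sigma> x. acts (layer_turn n X c) \<sigma> x"
proof -
  let ?S = "{p \<in> corners n. dot p (normal X) = c}"
  let ?m = "restrict_to (turn X) ?S"
  have m: "?m permutes corners n"
  proof (rule bij_imp_permutes)
    have "inj_on ?m (corners n)"
      by (rule inj_on_subset[OF inj_restrict_to[OF inj_turn]])
        (simp_all add: turn_mem_corners dot_turn_normal del: turn.simps)
    moreover have "?m ` corners n \<subseteq> corners n"
      by (auto simp: restrict_to_def turn_mem_corners simp del: turn.simps)
    ultimately show "bij_betw ?m (corners n) (corners n)"
      using finite_corners by (simp add: bij_betw_def endo_inj_surj)
  qed (simp add: restrict_to_def)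
  have "\<exists>t. layer_turn n X c (ref (inv ?m q)) = spins t (ref q)" if q: "q \<in> corners n" for q
  proof (rule same_corner_spins[OF ref_corner[OF q]])
    have p: "inv ?m q \<in> corners n" using q permutes_in_image[OF permutes_inv[OF m]] by blast
    show "layer_turn n X c (ref (inv ?m q)) \<in> facelets n"
      using ref_facelet[OF p] by (simp add: layer_turn_def turn_mem_facelets)
    have "cubie n (layer_turn n X c (ref (inv ?m q))) = ?m (inv ?m q)"
      using p ref_facelet[OF p] cubie_ref[OF p] by (simp add: layer_turn_def restrict_to_def cubie_turn')
    then show "cubie n (layer_turn n X c (ref (inv ?m q))) = cubie n (ref q)"
      using cubie_ref[OF q] permutes_inverses(1)[OF m] by simp
  qed
  then have "\<forall>q\<in>corners n. \<exists>t. layer_turn n X c (ref (inv ?m q)) = spins t (ref q)" by blast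
  from bchoice[OF this] obtain x
    where x: "\<forall>q\<in>corners n. layer_turn n X c (ref (inv ?m q)) = spins (x q) (ref q)" by blast
  have "layer_turn n X c (ref p) = spins (x (?m p)) (ref (?m p))" if p: "p \<in> corners n" for p
  proof -
    have "?m p \<in> corners n" using p permutes_in_image[OF m] by blast
    then have "layer_turn n X c (ref (inv ?m (?m p))) = spins (x (?m p)) (ref (?m p))" using x by blast
    then show ?thesis by (simp only: permutes_inverses(2)[OF m])
  qed
  then show ?thesis unfolding acts_def using m by blast
qed

text \<open>The total twist is a homomorphism to the integers modulo 3, so it kills the generators,
  which have order 4.\<close>

lemma total_twist_layer_turn:
  assumes "c \<in> layers" "acts (layer_turn n X c) \<sigma> x"
  shows "(\<Sum>p\<in>corners n. x p) = 0"
proof -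
  let ?t = "layer_turn n X c" and ?sum = "\<lambda>x. \<Sum>p\<in>corners n. x p :: 3"
  have t: "?t \<in> reachable n" using assms(1) by (rule layer_turn_reachable)
  obtain x2 where x2: "acts (?t \<circ> ?t) (\<sigma> \<circ> \<sigma>) x2" "?sum x2 = ?sum x + ?sum x"
    using acts_comp[OF assms(2,2) t] by blast
  obtain x4 where x4: "acts ((?t \<circ> ?t) \<circ> (?t \<circ> ?t)) ((\<sigma> \<circ> \<sigma>) \<circ> (\<sigma> \<circ> \<sigma>)) x4" "?sum x4 = ?sum x2 + ?sum x2"
    using acts_comp[OF x2(1) x2(1) reachable_comp[OF t t]] by blast
  have "(?t \<circ> ?t) \<circ> (?t \<circ> ?t) = id" using layer_turn_four[of X c] by (simp only: comp_assoc)
  then have "?sum x4 = 0" using acts_unique(2)[OF x4(1)] acts_id by (metis (no_types, lifting) sum.neutral)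
  then have "?sum x + ?sum x + (?sum x + ?sum x) = 0" using x2(2) x4(2) by simp
  then show ?thesis using three_cases[of "?sum x"] by auto
qed

lemma reachable_acts: "g \<in> reachable n \<Longrightarrow> \<exists>\<sigma> x. acts g \<sigma> x \<and> (\<Sum>p\<in>corners n. x p) = 0"
proof (induction rule: reachable_induct)
  case id
  show ?case using acts_id by (metis sum.neutral_const)
next
  case (layer_turn g X c)
  then obtain \<sigma> x where g: "acts g \<sigma> x" "(\<Sum>p\<in>corners n. x p) = 0" by blast
  obtain \<tau> y where t: "acts (layer_turn n X c) \<tau> y" using acts_layer_turn[OF layer_turn.hyps(2)] by blast
  have "(\<Sum>p\<in>corners n. y p) = 0" using total_twist_layer_turn[OF layer_turn.hyps(2) t] .
  then show ?case
    using acts_comp[OF t g(1) layer_turn_reachable[OF layer_turn.hyps(2)]] g(2) by fastforce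
qed

text \<open>A state with the right corner positions has orientations \<open>y\<close> of total zero,
  so the difference between \<open>x\<close> and \<open>y\<close> also has total zero and can be
  added by a pure twist.\<close>

lemma correct_twist:
  assumes "g \<in> reachable n" "\<sigma> permutes corners n"
    and "\<And>f. f \<in> corner_facelets \<Longrightarrow> cubie n (g f) = \<sigma> (cubie n f)"
    and "(\<Sum>p\<in>corners n. x p) = 0"
  shows "\<exists>d. twist d \<in> reachable n \<and> acts (twist d \<circ> g) \<sigma> x"
proof -
  obtain \<tau> y where y: "acts g \<tau> y" "(\<Sum>p\<in>corners n. y p) = 0" using reachable_acts[OF assms(1)] by blast
  have \<tau>: "\<tau> p = \<sigma> p" if p: "p \<in> corners n" for p
  proof -
    have q: "\<tau> p \<in> corners n" using p y(1) permutes_in_image by (metis acts_def)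
    have "cubie n (g (ref p)) = \<tau> p" using y(1) p q by (simp add: acts_def cubie_spins ref_corner cubie_ref)
    then show ?thesis using assms(3)[OF ref_corner[OF p]] cubie_ref[OF p] by simp
  qed
  let ?d = "\<lambda>p. x p - y p"
  have "twist ?d \<in> reachable n" by (rule twist_reachable) (simp add: sum_subtractf assms(4) y(2))
  moreover have "(twist ?d \<circ> g) (ref p) = spins (x (\<sigma> p)) (ref (\<sigma> p))" if p: "p \<in> corners n" for p
  proof -
    have q: "\<sigma> p \<in> corners n" using p assms(2) by (simp add: permutes_in_image)
    have "g (ref p) = spins (y (\<sigma> p)) (ref (\<sigma> p))" using y(1) p \<tau>[OF p] by (simp add: acts_def)
    then show ?thesis
      using ref_corner[OF q] by (simp add: twist_def spins_mem_corner_facelets cubie_spins cubie_ref[OF q] spins_spins)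
  qed
  ultimately show ?thesis unfolding acts_def using assms(2) by blast
qed

end

section \<open>Numbered corner faces and spins\<close>

context even_cube
begin

lemma corner_stickers:
  assumes "p \<in> corners n"
  shows "on_face n p X \<Longrightarrow> p + normal X \<in> facelets n \<and> cubie n (p + normal X) = p"
    and "on_face n p X \<Longrightarrow>
      \<exists>Y. Y \<noteq> X \<and> on_face n p Y \<and> (\<exists>Z. on_face n p Z \<and> turn X (normal Y) = normal Z)"
    and "on_face n p X \<Longrightarrow> Y \<noteq> X \<and> on_face n p Y \<and> (\<exists>Z. on_face n p Z \<and> turn X (normal Y) = normal Z) \<Longrightarrow>
      p + normal Y = spin (p + normal X)"
    and "\<exists>!X. X \<in> {w, opposite w} \<and> on_face n p X"
proof -
  define N where "N = outer"
  have N: "N > 0" "N + 1 = int n" "odd N" using n_ge_2 even_n by (auto simp: N_def)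
  have on: "on_face n p X \<longleftrightarrow> dot p (normal X) = N" for X
    by (simp add: on_face_def coord_def N_def)
  have sh: "shrink n (int n) = N" "shrink n (N + 1) = N" "shrink n N = N" "shrink n (- N) = - N" "shrink n (- N - 1) = - N"
    using N by (auto simp: shrink_def)
  have "p \<in> {N, -N} \<times> {N, -N} \<times> {N, -N}"
    using assms by (auto simp: corners_def coord_def N_def)
  then have p: "p = (N, N, N) \<or> p = (N, N, -N) \<or> p = (N, -N, N) \<or> p = (N, -N, -N) \<or>
    p = (-N, N, N) \<or> p = (-N, N, -N) \<or> p = (-N, -N, N) \<or> p = (-N, -N, -N)" by auto
  obtain a b c where xyz: "p = (a, b, c)" by (cases p)
  show "on_face n p X \<Longrightarrow> p + normal X \<in> facelets n \<and> cubie n (p + normal X) = p"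
    using p N unfolding on by (elim disjE; cases X; simp add: mem_facelets_iff sh)
  show "on_face n p X \<Longrightarrow>
      \<exists>Y. Y \<noteq> X \<and> on_face n p Y \<and> (\<exists>Z. on_face n p Z \<and> turn X (normal Y) = normal Z)"
    using p N unfolding on by (elim disjE; cases X; simp add: ex_face)
  show "on_face n p X \<Longrightarrow> Y \<noteq> X \<and> on_face n p Y \<and> (\<exists>Z. on_face n p Z \<and> turn X (normal Y) = normal Z) \<Longrightarrow>
      p + normal Y = spin (p + normal X)"
    using N(1) unfolding on unfolding xyz by (cases X; cases Y) (auto simp: ex_face)
  show "\<exists>!X. X \<in> {w, opposite w} \<and> on_face n p X"
  proof -
    have "\<bar>a\<bar> = N" "\<bar>b\<bar> = N" "\<bar>c\<bar> = N" using p xyz N(1) by auto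
    then have "\<exists>!X. (X = w \<or> X = opposite w) \<and> dot (a, b, c) (normal X) = N"
      using N(1) by (cases w) (auto simp: Ex1_def ex_face abs_if split: if_splits)
    then show ?thesis unfolding on unfolding xyz by simp
  qed
qed

lemma clockwise_next_sticker:
  assumes "p \<in> corners n" "on_face n p X"
  shows "on_face n p (clockwise_next n p X)" "p + normal (clockwise_next n p X) = spin (p + normal X)"
proof -
  let ?Q = "\<lambda>Y. Y \<noteq> X \<and> on_face n p Y \<and> (\<exists>Z. on_face n p Z \<and> turn X (normal Y) = normal Z)"
  obtain Y where Y: "?Q Y" using corner_stickers(2)[OF assms] by blast
  have eq: "p + normal Y' = spin (p + normal X)" if "?Q Y'" for Y' using corner_stickers(3)[OF assms that] .
  have "Y' = Y" if "?Q Y'" for Y'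
    using eq[OF that] eq[OF Y] by (metis add_left_cancel inj_eq inj_normal)
  then have "clockwise_next n p X = Y" unfolding clockwise_next_def using Y by (intro the_equality)
  then show "on_face n p (clockwise_next n p X)" "p + normal (clockwise_next n p X) = spin (p + normal X)"
    using Y eq[OF Y] by auto
qed

text \<open>The faces numbered by \<open>corner_face\<close> are met by successive spins. This turns
  the addition of orientations in \<open>describes\<close> into the composition of spins.\<close>

lemma corner_face_sticker:
  assumes "p \<in> corners n"
  shows "p + normal (corner_face n w p 0) \<in> facelets n" "cubie n (p + normal (corner_face n w p 0)) = p"
    and "p + normal (corner_face n w p j) = spins j (p + normal (corner_face n w p 0))"
proof -
  define X where "X = (THE X. X \<in> {w, opposite w} \<and> on_face n p X)"
  have X: "on_face n p X" unfolding X_def using theI'[OF corner_stickers(4)[OF assms]] by blast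
  have cj: "corner_face n w p j = (if j = 0 then X else if j = 1 then clockwise_next n p X
      else clockwise_next n p (clockwise_next n p X))" for j
    unfolding corner_face_def Let_def X_def ..
  have c0: "corner_face n w p 0 = X" by (simp add: cj)
  show "p + normal (corner_face n w p 0) \<in> facelets n" "cubie n (p + normal (corner_face n w p 0)) = p"
    unfolding c0 using corner_stickers(1)[OF assms X] by blast+
  show "p + normal (corner_face n w p j) = spins j (p + normal (corner_face n w p 0))"
    unfolding c0 using clockwise_next_sticker[OF assms X]
      clockwise_next_sticker[OF assms clockwise_next_sticker(1)[OF assms X]]
    by (simp add: cj spins_def del: spin.simps)
qed

end

section \<open>Assembly\<close>

context even_cube
begin

text \<open>The orbits are indexed by pairs: \<open>(1, 1)\<close> for the corners, \<open>(1, i)\<close> for the coupled edges,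
  \<open>(i, i)\<close> for the center corners and \<open>(i, j)\<close> for the center edges.\<close>

definition orbits :: "(nat \<times> nat) set" where
  "orbits = {(i, j). (i = 1 \<or> i \<in> orbit_indices n) \<and> (j \<in> orbit_indices n \<or> i = 1 \<and> j = 1)}"

definition orbit_key :: "nat \<times> nat \<Rightarrow> point \<Rightarrow> point" where
  "orbit_key k = (if fst k = 1 then cubie n else id)"

text \<open>As \<open>lay 1\<close> is \<open>outer\<close>, the same formula gives the base points
  of corners, edges and both kinds of centers; only the height distinguishes cubies from
  facelets.\<close>

definition orbit_base :: "nat \<times> nat \<Rightarrow> point" where
  "orbit_base k = (lay (snd k), if fst k = 1 then outer else int n, lay (fst k))"

definition orbit_facelets :: "nat \<times> nat \<Rightarrow> point set" where
  "orbit_facelets k = {f \<in> facelets n. orbit_key k f \<in> rots (orbit_base k)}"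

lemma one_notin_orbit_indices: "1 \<notin> orbit_indices n"
  by (simp add: orbit_indices_def)

lemma finite_orbits: "finite orbits"
  by (rule finite_subset[of _ "{..n} \<times> {..n}"]) (use n_ge_2 in \<open>auto simp: orbits_def orbit_indices_def\<close>)

lemma lay_orbits:
  assumes "(i, j) \<in> orbits"
  shows "lay i \<in> layers" "lay j \<in> layers"
  using assms orbit_index(3) lay_mem_layers[of 1] n_ge_2 by (auto simp: orbits_def)

lemma keyed_orbits:
  assumes "(i, j) \<in> orbits"
  shows "keyed_orbit n (orbit_key (i, j)) (orbit_base (i, j)) (lay j) (lay i)"
proof (cases "i = 1")
  case True
  then show ?thesis
    using keyed_orbit_cubie[OF lay_orbits(2,1)[OF assms]] by (simp add: orbit_key_def orbit_base_def)
next
  case False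
  then have "i \<in> orbit_indices n" "j \<in> orbit_indices n" using assms by (auto simp: orbits_def)
  then show ?thesis
    using keyed_orbit_center[OF lay_orbits(2,1)[OF assms]] orbit_index(5) False
    by (simp add: orbit_key_def orbit_base_def)
qed

text \<open>The U sticker of the base cubie has the first label. Further stickers exist only on
  edges and corners, that is for \<open>i = 1\<close>, and may show the reversed label.\<close>

lemma base_facelet_label:
  assumes "(i, j) \<in> orbits" "f \<in> facelets n" "cubie n f = (lay j, outer, lay i)"
  shows "label n f = (lay j, lay i) \<or> i = 1 \<and> label n f = (lay i, lay j)"
proof -
  have l: "0 < lay i" "lay i < int n" "0 < lay j" "lay j < int n"
    using lay_orbits[OF assms(1)] by (auto simp: layers_def)
  have i: "lay i < outer" if "i \<noteq> 1" using that assms(1) orbit_index(5) by (auto simp: orbits_def)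
  have j: "lay j < outer" if "i \<noteq> 1" using that assms(1) orbit_index(5) by (auto simp: orbits_def)
  obtain x y z where f: "f = (x, y, z)" by (cases f)
  have shrink_cases: "t = c \<or> t = int n \<and> c = outer" if "shrink n t = c" "0 < c" for t c
    using that by (auto simp: shrink_def split: if_splits)
  have "x = lay j \<or> x = int n \<and> lay j = outer" "y = outer \<or> y = int n" "z = lay i \<or> z = int n \<and> lay i = outer"
    using assms(3) shrink_cases[of x] shrink_cases[of y outer] shrink_cases[of z] l n_ge_2 by (auto simp: f)
  then consider "x = lay j" "y = int n" "z = lay i" | "x = int n" "y = outer" "z = lay i" "lay j = outer"
    | "x = lay j" "y = outer" "z = int n" "lay i = outer"
    using assms(2) l by (elim disjE conjE; simp add: f mem_facelets_iff)
  then show ?thesis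
  proof cases
    case 1
    then show ?thesis using l by (simp add: f)
  next
    case 2
    then have "i = 1" using j by auto
    then show ?thesis using 2 l by (simp add: f)
  next
    case 3
    then have "i = 1" using i by auto
    then show ?thesis using 3 l by (auto simp: f)
  qed
qed

lemma orbit_facelet_label:
  assumes "(i, j) \<in> orbits" "f \<in> orbit_facelets (i, j)"
  shows "label n f = (lay j, lay i) \<or> i = 1 \<and> label n f = (lay i, lay j)"
proof -
  interpret keyed_orbit n "orbit_key (i, j)" "orbit_base (i, j)" "lay j" "lay i"
    using assms(1) by (rule keyed_orbits)
  have f: "f \<in> facelets n" "orbit_key (i, j) f \<in> rots (orbit_base (i, j))"
    using assms(2) by (simp_all add: orbit_facelets_def)
  have "cubie n ` rots (orbit_base (i, j)) \<subseteq> rots (lay j, outer, lay i)"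
  proof -
    have base: "cubie n (orbit_base (i, j)) = (lay j, outer, lay i)"
      using lay_orbits[OF assms(1)] n_ge_2 by (auto simp: orbit_base_def shrink_def layers_def)
    have "rots (orbit_base (i, j)) \<subseteq> {p. cubie n p \<in> rots (lay j, outer, lay i)}"
      by (rule rots_subset)
        (simp_all only: mem_Collect_eq base self_mem_rots cubie_turn' turn_mem_rots_iff)
    then show ?thesis by blast
  qed
  then have "cubie n f \<in> rots (lay j, outer, lay i)" using f cubie_key[of f] by (metis image_subset_iff)
  with f(1) show ?thesis
  proof (induction rule: cubie_rots_induct)
    case (base f)
    then show ?case using base_facelet_label[OF assms(1)] by blast
  next
    case (turn f X)
    then show ?case by (simp only: label_turn)
  qed
qed

text \<open>The label reveals the index pair up to the reversal that occurs for edges. The reversed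
  pair of an edge orbit would be \<open>(i, 1)\<close> with \<open>i\<close> different from 1, which
  indexes no orbit.\<close>

lemma orbits_disjoint:
  assumes "k \<in> orbits" "k' \<in> orbits" "k \<noteq> k'"
  shows "orbit_facelets k \<inter> orbit_facelets k' = {}"
proof (rule ccontr)
  assume "orbit_facelets k \<inter> orbit_facelets k' \<noteq> {}"
  then obtain f where f: "f \<in> orbit_facelets k" "f \<in> orbit_facelets k'" by blast
  obtain i j i' j' where k: "k = (i, j)" "k' = (i', j')" by (cases k; cases k')
  have "label n f = (lay j, lay i) \<or> i = 1 \<and> label n f = (lay i, lay j)"
    "label n f = (lay j', lay i') \<or> i' = 1 \<and> label n f = (lay i', lay j')"
    using orbit_facelet_label assms f unfolding k by blast+
  then have "(i = i' \<and> j = j') \<or> i = 1 \<and> i = j' \<and> j = i' \<or> i' = 1 \<and> i = j' \<and> j = i'"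
    by (auto simp: lay_eq_iff simp del: label.simps)
  moreover have "i = 1 \<or> j \<noteq> 1" "i' = 1 \<or> j' \<noteq> 1"
    using assms one_notin_orbit_indices unfolding k orbits_def by auto
  ultimately show False using assms(3) unfolding k by auto
qed

lemma facelet_of_center:
  assumes "(i, j) \<in> orbits" "i \<noteq> 1" "f \<in> rots (orbit_base (i, j))"
  shows "f \<in> facelets n"
proof -
  have "orbit_base (i, j) \<in> facelets n"
    using lay_orbits[OF assms(1)] assms(2) by (simp add: orbit_base_def mem_facelets_iff layers_def)
  then have "rots (orbit_base (i, j)) \<subseteq> facelets n"
    by (rule rots_subset) (simp_all only: turn_mem_facelets)
  then show ?thesis using assms(3) by blast
qed

text \<open>Each coordinate of the base point contributes one factor. For edges \<open>outer\<close>
  occurs twice and cancels, while for corners the three equal coordinates yield only one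
  ring.\<close>

lemma key_turn_sign_orbit:
  assumes "(i, j) \<in> orbits" "V \<subseteq> layers"
  shows "keyed_orbit.key_turn_sign n (orbit_base (i, j)) V =
    (if i = 1 \<and> j = 1 then parity (outer \<in> V)
     else if i = 1 then parity (lay j \<in> V)
     else parity (outer \<in> V) * parity (lay i \<in> V) * parity (lay j \<in> V))"
proof -
  interpret keyed_orbit n "orbit_key (i, j)" "orbit_base (i, j)" "lay j" "lay i"
    using assms(1) by (rule keyed_orbits)
  have pos: "0 < lay i" "0 < lay j" "0 < outer" "0 < int n" using lay_orbits[OF assms(1)] n_ge_2 by (auto simp: layers_def)
  have sh: "shrink n (lay i) = lay i" "shrink n (lay j) = lay j" "shrink n outer = outer" "shrink n (int n) = outer"
    using lay_orbits[OF assms(1)] n_ge_2 by (auto simp: layers_def shrink_def)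
  have sq: "parity P * parity P = 1" for P by (simp add: parity_def)
  consider "i = 1" "j = 1" | "i = 1" "j \<noteq> 1" | "i \<noteq> 1" by blast
  then show ?thesis
  proof cases
    case 1
    then have "orbit_base (i, j) = (outer, outer, outer)" by (simp add: orbit_base_def lay_1)
    then show ?thesis using key_turn_sign_corner[OF _ pos(3) assms(2)] 1 sh by simp
  next
    case 2
    then have "orbit_base (i, j) = (lay j, outer, outer)" "lay j \<noteq> outer"
      using lay_eq_iff[of j 1] by (simp_all add: orbit_base_def lay_1)
    then show ?thesis using key_turn_sign_generic[OF _ pos(2,3,3) _ assms(2)] 2 sh sq by (simp add: mult.assoc)
  next
    case 3
    then have "orbit_base (i, j) = (lay j, int n, lay i)" "lay i \<noteq> int n"
      using lay_orbits[OF assms(1)] by (auto simp: orbit_base_def layers_def)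
    then show ?thesis using key_turn_sign_generic[OF _ pos(2,4,1) _ assms(2)] 3 sh by (simp add: mult_ac)
  qed
qed

lemma parity_sign: "parity (sign p \<noteq> 1) = sign p"
  by (cases p rule: sign_cases) (simp_all add: parity_def)

theorem realize_permutations:
  assumes "\<sigma> permutes corners n"
    and "\<And>i. i \<in> orbit_indices n \<Longrightarrow> \<tau> i permutes coupled_edges n i"
    and "\<And>i. i \<in> orbit_indices n \<Longrightarrow> \<rho>c i permutes center_corners n i"
    and "\<And>i j. i \<in> orbit_indices n \<Longrightarrow> j \<in> orbit_indices n \<Longrightarrow> j \<noteq> i \<Longrightarrow> \<rho>e i j permutes center_edges n i j"
    and "\<And>i. i \<in> orbit_indices n \<Longrightarrow> sign \<sigma> = sign (\<rho>c i)"
    and "\<And>i j. i \<in> orbit_indices n \<Longrightarrow> j \<in> orbit_indices n \<Longrightarrow> j \<noteq> i \<Longrightarrow>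
           sign (\<rho>e i j) = sign \<sigma> * sign (\<tau> i) * sign (\<tau> j)"
  shows "\<exists>g\<in>reachable n.
    (\<forall>f\<in>facelets n. cubie n f \<in> corners n \<longrightarrow> cubie n (g f) = \<sigma> (cubie n f)) \<and>
    (\<forall>i\<in>orbit_indices n. \<forall>f\<in>facelets n. cubie n f \<in> coupled_edges n i \<longrightarrow> cubie n (g f) = \<tau> i (cubie n f)) \<and>
    (\<forall>i\<in>orbit_indices n. \<forall>f\<in>center_corners n i. g f = \<rho>c i f) \<and>
    (\<forall>i\<in>orbit_indices n. \<forall>j\<in>orbit_indices n. j \<noteq> i \<longrightarrow> (\<forall>f\<in>center_edges n i j. g f = \<rho>e i j f))"
proof -
  define \<pi> where "\<pi> = (\<lambda>(i, j). if i = 1 \<and> j = 1 then \<sigma> else if i = (1::nat) then \<tau> j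
    else if i = j then \<rho>c i else \<rho>e i j)"
  \<comment> \<open>The turned layers are those whose corner or edge permutation is odd. The
    hypotheses on the signs then say that the turn has the right sign on the centers too; for center
    corners the factor of \<open>lay i\<close> is squared and only that of \<open>outer\<close>
    remains.\<close>
  define V where "V = {lay i |i. i \<in> orbit_indices n \<and> sign (\<tau> i) \<noteq> 1} \<union> {c. c = outer \<and> sign \<sigma> \<noteq> 1}"
  have V: "V \<subseteq> layers" using orbit_index(3) outer_mem_layers by (auto simp: V_def)
  have outer_V: "outer \<in> V \<longleftrightarrow> sign \<sigma> \<noteq> 1" using orbit_index(5) by (force simp: V_def)
  have lay_V: "lay i \<in> V \<longleftrightarrow> sign (\<tau> i) \<noteq> 1" if "i \<in> orbit_indices n" for i
    using that orbit_index(5)[OF that] by (auto simp: V_def lay_eq_iff)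
  have real: "\<exists>h\<in>reachable n. (\<forall>f. f \<notin> orbit_facelets k \<longrightarrow> h f = f) \<and> (\<forall>f\<in>orbit_facelets k. h f \<in> orbit_facelets k) \<and>
    (\<forall>f\<in>orbit_facelets k. layers_turn V f \<in> orbit_facelets k \<and>
      orbit_key k (h (layers_turn V f)) = \<pi> k (orbit_key k f))" if k: "k \<in> orbits" for k
  proof -
    obtain i j where ij: "k = (i, j)" by (cases k)
    have oij: "(i, j) \<in> orbits" using k ij by simp
    interpret keyed_orbit n "orbit_key (i, j)" "orbit_base (i, j)" "lay j" "lay i"
      using oij by (rule keyed_orbits)
    define s where "s = key_turn_sign V"
    note s = key_turn_sign_orbit[OF oij V, folded s_def]
    consider "i = 1" "j = 1" | "i = 1" "j \<in> orbit_indices n" "j \<noteq> 1" | "i \<in> orbit_indices n" "j = i" "i \<noteq> 1"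
      | "i \<in> orbit_indices n" "j \<in> orbit_indices n" "j \<noteq> i" "i \<noteq> 1"
      using oij one_notin_orbit_indices by (auto simp: orbits_def)
    then have "\<pi> (i, j) permutes rots (orbit_base (i, j)) \<and> sign (\<pi> (i, j)) = s"
    proof cases
      case 1
      then show ?thesis
        using assms(1) parity_sign[of \<sigma>] corners_eq
        by (simp add: s outer_V \<pi>_def orbit_base_def lay_1 del: rots.simps)
    next
      case 2
      then show ?thesis
        using assms(2)[OF 2(2)] parity_sign[of "\<tau> j"] coupled_edges_eq[OF 2(2)]
        by (simp add: s lay_V \<pi>_def orbit_base_def lay_1 del: rots.simps)
    next
      case 3
      then show ?thesis
        using assms(3,5)[OF 3(1)] parity_sign[of \<sigma>] parity_sign[of "\<tau> i"] center_corners_eq[OF 3(1)]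
        by (simp add: s lay_V outer_V \<pi>_def orbit_base_def mult.assoc del: rots.simps)
    next
      case 4
      then show ?thesis
        using assms(4,6)[OF 4(1-3)] parity_sign[of \<sigma>] parity_sign[of "\<tau> i"] parity_sign[of "\<tau> j"]
          center_edges_eq[OF 4(1,2)]
        by (simp add: s lay_V outer_V \<pi>_def orbit_base_def del: rots.simps)
    qed
    moreover have "block = orbit_facelets k" unfolding block_def orbit_facelets_def ij ..
    ultimately show ?thesis using block_realization[OF V, of "\<pi> (i, j)"] unfolding ij s_def by (simp only:)
  qed
  obtain H where H: "\<forall>k\<in>orbits. H k \<in> reachable n \<and> (\<forall>f. f \<notin> orbit_facelets k \<longrightarrow> H k f = f) \<and>
    (\<forall>f\<in>orbit_facelets k. H k f \<in> orbit_facelets k) \<and>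
    (\<forall>f\<in>orbit_facelets k. layers_turn V f \<in> orbit_facelets k \<and>
      orbit_key k (H k (layers_turn V f)) = \<pi> k (orbit_key k f))"
  proof -
    have "\<forall>k\<in>orbits. \<exists>h. h \<in> reachable n \<and> (\<forall>f. f \<notin> orbit_facelets k \<longrightarrow> h f = f) \<and>
      (\<forall>f\<in>orbit_facelets k. h f \<in> orbit_facelets k) \<and>
      (\<forall>f\<in>orbit_facelets k. layers_turn V f \<in> orbit_facelets k \<and>
        orbit_key k (h (layers_turn V f)) = \<pi> k (orbit_key k f))" using real by blast
    from bchoice[OF this] show ?thesis using that by blast
  qed
  \<comment> \<open>The layer turn preserves every orbit, so the corrections can be merged into one
    state \<open>h\<close> that follows it.\<close>
  have "\<exists>h\<in>reachable n. (\<forall>k\<in>orbits. \<forall>f\<in>orbit_facelets k. h f = H k f) \<and>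
    (\<forall>f. f \<notin> (\<Union>k\<in>orbits. orbit_facelets k) \<longrightarrow> h f = f)"
    by (rule finite_composition[OF finite_orbits]) (use H orbits_disjoint in blast)+
  then obtain h where h: "h \<in> reachable n" "\<forall>k\<in>orbits. \<forall>f\<in>orbit_facelets k. h f = H k f" by blast
  define g where "g = h \<circ> layers_turn V"
  have g: "g \<in> reachable n" unfolding g_def using h(1) layers_turn_reachable[OF V] by (rule reachable_comp)
  have key_g: "orbit_key k (g f) = \<pi> k (orbit_key k f)" if "k \<in> orbits" "f \<in> orbit_facelets k" for k f
    using that H h(2) by (simp add: g_def)
  have "cubie n (g f) = \<sigma> (cubie n f)" if "f \<in> facelets n" "cubie n f \<in> corners n" for f
    using key_g[of "(1, 1)" f] that corners_eq
    by (simp add: orbits_def orbit_facelets_def orbit_key_def orbit_base_def lay_1 \<pi>_def del: rots.simps)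
  moreover have "cubie n (g f) = \<tau> i (cubie n f)"
    if "i \<in> orbit_indices n" "f \<in> facelets n" "cubie n f \<in> coupled_edges n i" for i f
  proof -
    have "i \<noteq> 1" using that one_notin_orbit_indices by blast
    then show ?thesis using key_g[of "(1, i)" f] that coupled_edges_eq[of i]
      by (simp add: orbits_def orbit_facelets_def orbit_key_def orbit_base_def lay_1 \<pi>_def del: rots.simps)
  qed
  moreover have "g f = \<rho>c i f" if "i \<in> orbit_indices n" "f \<in> center_corners n i" for i f
  proof -
    have "i \<noteq> 1" using that one_notin_orbit_indices by blast
    moreover have "(i, i) \<in> orbits" using that by (simp add: orbits_def)
    moreover have "f \<in> rots (orbit_base (i, i))"
      using that center_corners_eq[of i] \<open>i \<noteq> 1\<close> by (simp add: orbit_base_def del: rots.simps)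
    ultimately show ?thesis using key_g[of "(i, i)" f] facelet_of_center[of i i f]
      by (simp add: orbit_facelets_def orbit_key_def \<pi>_def del: rots.simps)
  qed
  moreover have "g f = \<rho>e i j f"
    if "i \<in> orbit_indices n" "j \<in> orbit_indices n" "j \<noteq> i" "f \<in> center_edges n i j" for i j f
  proof -
    have "i \<noteq> 1" using that one_notin_orbit_indices by blast
    moreover have "(i, j) \<in> orbits" using that by (simp add: orbits_def)
    moreover have "f \<in> rots (orbit_base (i, j))"
      using that center_edges_eq[of i j] \<open>i \<noteq> 1\<close> by (simp add: orbit_base_def del: rots.simps)
    ultimately show ?thesis using key_g[of "(i, j)" f] facelet_of_center[of i j f] that(3)
      by (simp add: orbit_facelets_def orbit_key_def \<pi>_def del: rots.simps)
  qed
  ultimately show ?thesis using g by blast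
qed

end

theorem theorem18:
  fixes n :: nat and w :: face
    and \<sigma> :: "point \<Rightarrow> point" and \<tau> :: "nat \<Rightarrow> point \<Rightarrow> point"
    and \<rho>c :: "nat \<Rightarrow> point \<Rightarrow> point" and \<rho>e :: "nat \<Rightarrow> nat \<Rightarrow> point \<Rightarrow> point"
    and x :: "point \<Rightarrow> 3" and y :: "nat \<Rightarrow> point \<Rightarrow> 2"
  assumes "n \<ge> 2" and "even n"
    and "(\<sigma>, \<tau>, \<rho>c, \<rho>e, x, y) \<in> S_conf n"
    and "\<And>i. i \<in> orbit_indices n \<Longrightarrow> sign \<sigma> = sign (\<rho>c i)"
    and "\<And>i j. i \<in> orbit_indices n \<Longrightarrow> j \<in> orbit_indices n \<Longrightarrow> j \<noteq> i \<Longrightarrow>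
           sign (\<rho>e i j) = sign \<sigma> * sign (\<tau> i) * sign (\<tau> j)"
    and "(\<Sum>p\<in>corners n. x p) = 0"
    and "\<And>i p. i \<in> orbit_indices n \<Longrightarrow> p \<in> coupled_edges n i \<Longrightarrow> y i p = 0"
  shows "valid n w (\<sigma>, \<tau>, \<rho>c, \<rho>e, x, y)"
proof -
  interpret even_cube n using assms(1,2) by unfold_locales
  \<comment> \<open>The reference sticker is the one on the white or yellow face, from which
    \<open>x\<close> is measured.\<close>
  define ref where "ref p = p + normal (corner_face n w p 0)" for p
  interpret corner_reference n ref
    using corner_face_sticker(1,2) by unfold_locales (simp_all add: ref_def)
  have perm: "\<sigma> permutes corners n"
    "\<And>i. i \<in> orbit_indices n \<Longrightarrow> \<tau> i permutes coupled_edges n i"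
    "\<And>i. i \<in> orbit_indices n \<Longrightarrow> \<rho>c i permutes center_corners n i"
    "\<And>i j. i \<in> orbit_indices n \<Longrightarrow> j \<in> orbit_indices n \<Longrightarrow> j \<noteq> i \<Longrightarrow> \<rho>e i j permutes center_edges n i j"
    using assms(3) by (auto simp: S_conf_def)
  obtain g where g: "g \<in> reachable n"
    and g_corner: "\<forall>f\<in>facelets n. cubie n f \<in> corners n \<longrightarrow> cubie n (g f) = \<sigma> (cubie n f)"
    and g_edge: "\<forall>i\<in>orbit_indices n. \<forall>f\<in>facelets n. cubie n f \<in> coupled_edges n i \<longrightarrow> cubie n (g f) = \<tau> i (cubie n f)"
    and g_cc: "\<forall>i\<in>orbit_indices n. \<forall>f\<in>center_corners n i. g f = \<rho>c i f"
    and g_ce: "\<forall>i\<in>orbit_indices n. \<forall>j\<in>orbit_indices n. j \<noteq> i \<longrightarrow> (\<forall>f\<in>center_edges n i j. g f = \<rho>e i j f)"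
    using realize_permutations[OF perm assms(4,5)] by blast
  obtain d where d: "twist d \<in> reachable n" "acts (twist d \<circ> g) \<sigma> x"
    using correct_twist[OF g perm(1) _ assms(6)] g_corner unfolding corner_facelets_def by blast
  define g' where "g' = twist d \<circ> g"
  have g': "g' \<in> reachable n" unfolding g'_def using d(1) g by (rule reachable_comp)
  have cubie_twist: "cubie n (twist d f) = cubie n f" for f
    by (simp add: twist_def cubie_spins)
  \<comment> \<open>The twist leaves the centers in place: their cubies have coordinates below
    \<open>outer\<close> in absolute value and are no corners.\<close>
  have center: "twist d f = f" if "f \<in> rots (a, int n, b)" "a < outer" "b \<in> layers" "a \<in> layers" for a b f
  proof -
    have "f \<notin> corner_facelets"
    proof
      assume "f \<in> corner_facelets"
      then have "cubie n f \<in> corners n" by (simp add: corner_facelets_def)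
      moreover have "rots (a, int n, b) \<subseteq> {f. cubie n f \<notin> corners n}"
      proof (rule rots_subset)
        show "(a, int n, b) \<in> {f. cubie n f \<notin> corners n}"
          using that(2-4) by (auto simp: corners_def coord_def shrink_def layers_def)
      qed (simp_all only: mem_Collect_eq cubie_turn' turn_mem_corners not_False_eq_True)
      ultimately show False using that(1) by blast
    qed
    then show ?thesis by (simp add: twist_def)
  qed
  have "g' (p + normal (corner_face n w p j)) = \<sigma> p + normal (corner_face n w (\<sigma> p) (j + x (\<sigma> p)))"
    if p: "p \<in> corners n" for p j
  proof -
    have q: "\<sigma> p \<in> corners n" using p perm(1) by (simp add: permutes_in_image)
    have "g' (p + normal (corner_face n w p j)) = g' (spins j (ref p))"
      by (simp add: corner_face_sticker(3)[OF p, of w j] ref_def)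
    also have "\<dots> = spins j (g' (ref p))"
      using reachable_corner_facelet[OF g' ref_corner[OF p]] by blast
    also have "g' (ref p) = spins (x (\<sigma> p)) (ref (\<sigma> p))" using d(2) p by (simp add: acts_def g'_def)
    also have "spins j \<dots> = spins (j + x (\<sigma> p)) (ref (\<sigma> p))" using spins_spins[OF ref_corner[OF q]] .
    also have "\<dots> = \<sigma> p + normal (corner_face n w (\<sigma> p) (j + x (\<sigma> p)))"
      by (simp add: corner_face_sticker(3)[OF q, of w "j + x (\<sigma> p)"] ref_def)
    finally show ?thesis .
  qed
  moreover have "g' (p + normal (edge_face n p j)) = \<tau> i p + normal (edge_face n (\<tau> i p) (j + y i (\<tau> i p)))"
    if "i \<in> orbit_indices n" "p \<in> coupled_edges n i" for i p j
  proof -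
    have q: "\<tau> i p \<in> coupled_edges n i" using that perm(2) by (simp add: permutes_in_image)
    \<comment> \<open>Only the position of the edge had to be arranged; its stickers follow with
      orientation 0, which is what \<open>y\<close> prescribes.\<close>
    have "g' (p + normal (edge_face n p j)) = \<tau> i p + normal (edge_face n (\<tau> i p) j)"
      using that(1) g' that(2) _ q
    proof (rule reachable_edge_sticker)
      fix f assume "f \<in> facelets n" "cubie n f = p"
      then show "cubie n (g' f) = \<tau> i p" using g_edge that by (simp add: g'_def cubie_twist)
    qed
    then show ?thesis using assms(7)[OF that(1) q] by simp
  qed
  moreover have "g' f = \<rho>c i f" if "i \<in> orbit_indices n" "f \<in> center_corners n i" for i f
  proof -
    have "\<rho>c i f \<in> rots (lay i, int n, lay i)"
      using permutes_in_image[OF perm(3)[OF that(1)]] that(2) center_corners_eq[OF that(1)] by blast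
    then show ?thesis
      using g_cc that center orbit_index(3,5)[OF that(1)] by (simp add: g'_def del: rots.simps)
  qed
  moreover have "g' f = \<rho>e i j f"
    if "i \<in> orbit_indices n" "j \<in> orbit_indices n" "j \<noteq> i" "f \<in> center_edges n i j" for i j f
  proof -
    have "\<rho>e i j f \<in> rots (lay j, int n, lay i)"
      using permutes_in_image[OF perm(4)[OF that(1-3)]] that(4) center_edges_eq[OF that(1,2)] by blast
    then show ?thesis
      using g_ce that center orbit_index(3,5)[OF that(1)] orbit_index(3,5)[OF that(2)]
      by (simp add: g'_def del: rots.simps)
  qed
  ultimately have "describes n w (\<sigma>, \<tau>, \<rho>c, \<rho>e, x, y) g'" unfolding describes.simps by blast
  then show ?thesis unfolding valid_def using g' by blast
qed

end
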